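(* Let $p>3$ be a prime and let $W_n=\sum_{k=0}^{[n/3]}\binom{2k}k\binom{3k}k\binom n{3k}(-3)^{n-3k}$ for $n\ge 0$. Then $$\sum_{n=0}^{p-1}\frac{W_n}{(-3)^n}\equiv\sum_{k=0}^{[p/3]}\frac{\binom{2k}k\binom{3k}k}{27^k}\cdot\frac p{3k+1}\equiv\begin{cases}-L+\frac pL\pmod{p^2}&\text{if }p\equiv1\pmod 3,\text{ where }4p=L^2+27M^2\text{ with }L,M\in\mathbb Z,\ L\equiv1\pmod 3,\\ -\frac p3\left(\left(\frac{p-2}3\right)!\right)^3\pmod{p^2}&\text{if }p\equiv 2\pmod 3.\end{cases}$$
   Context: $[x]$ denotes the greatest integer not exceeding $x$. Congruences are taken in the ring $\mathbb Z_p$ of rational numbers whose denominators are not divisible by $p$. For $p\equiv 1\pmod 3$, integers $L,M$ with $4p=L^2+27M^2$ and $L\equiv 1\pmod 3$ exist. *)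

theory Defs
  imports "HOL-Number_Theory.Number_Theory"
begin

definition p_integral :: "nat \<Rightarrow> rat set" where
  "p_integral p = {x. \<not> int p dvd snd (quotient_of x)}"

text \<open>Congruence in the ring \<open>p_integral p\<close> modulo the ideal generated by \<open>m\<close>;
  both sides are required to lie in the ring.\<close>

definition cong_p_integral :: "nat \<Rightarrow> rat \<Rightarrow> rat \<Rightarrow> rat \<Rightarrow> bool" where
  "cong_p_integral p m x y \<longleftrightarrow>
     x \<in> p_integral p \<and> y \<in> p_integral p \<and> (\<exists>z \<in> p_integral p. x - y = m * z)"

definition W :: "nat \<Rightarrow> int" where
  "W n = (\<Sum>k = 0..n div 3.
     int ((2 * k) choose k) * int ((3 * k) choose k) * int (n choose (3 * k)) * (- 3) ^ (n - 3 * k))"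

end

theory Submission
  imports Defs "HOL-Computational_Algebra.Formal_Power_Series"
begin

text \<open>
  Interchanging the sums turns the left-hand side into
  \<open>\<Sum>k. (3 k)! / (k! ^ 3 * (- 27) ^ k) * (p choose (3 k + 1))\<close>, and
  \<open>(p choose (3 k + 1)) = p / (3 k + 1) * ((p - 1) choose (3 k))\<close>.  Modulo \<open>p\<close> the coefficient
  \<open>(3 k)! / (27 ^ k * k! ^ 3)\<close> agrees with \<open>(- 1) ^ k * (m choose k) * ((m + k) choose k)\<close>,
  where \<open>m = p div 3\<close>, and the partial fraction expansion of
  \<open>(\<Prod>i = 1..m. i - x) / (\<Prod>i = 0..m. x + i)\<close> at \<open>x = 1 / 3\<close> sums the terms in closed form.
  For \<open>p = 3 m + 2\<close> Wilson's theorem finishes the proof.  For \<open>p = 3 m + 1\<close> the value is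
  \<open>(2 m) choose m\<close> modulo \<open>p\<^sup>2\<close>, thanks to
  \<open>3 ^ (p - 1) = 1 - 2 / 3 * p * (\<Sum>i = 1..m. 1 / i)\<close> modulo \<open>p\<^sup>2\<close>.

  It remains to see that \<open>(2 m) choose m\<close> is \<open>- L + p / L\<close> modulo \<open>p\<^sup>2\<close>.  The Jacobi sum
  \<open>J = A + B w\<close> of a cubic character has norm \<open>p\<close>, \<open>3\<close> divides \<open>B\<close>, and \<open>J + J' = L\<close>, \<open>J * J' = p\<close>
  for its conjugate \<open>J'\<close>.  Sending \<open>w\<close> to a cube root of unity modulo \<open>p\<^sup>2\<close> makes one of
  \<open>J\<close>, \<open>J'\<close> a unit \<open>u\<close>, so that \<open>u = L - p / L\<close> modulo \<open>p\<^sup>2\<close>.  On the other hand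
  \<open>u = (\<Sum>x. (x * (1 - x)) ^ (2 m p))\<close>, which Teichmueller representatives \<open>x\<close> reduce to
  power sums, giving \<open>u = - ((2 m) choose m)\<close>.
\<close>

section \<open>Congruences between p-integral rationals\<close>

locale prime_local =
  fixes p :: nat
  assumes prime_p: "prime p"
begin

abbreviation Zp :: "rat set" where "Zp \<equiv> p_integral p"

abbreviation pcong :: "rat \<Rightarrow> nat \<Rightarrow> rat \<Rightarrow> bool" ("(_ \<approx>[_] _)" [51, 0, 51] 50)
  where "x \<approx>[e] y \<equiv> cong_p_integral p (of_nat p ^ e) x y"

lemma prime_int_p: "prime (int p)"
  using prime_p by simp

text \<open>The reduced denominator divides every other one, so from here on any fraction with
  denominator prime to \<open>p\<close> can stand in for \<open>quotient_of\<close>.\<close>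

lemma Zp_iff: "x \<in> Zp \<longleftrightarrow> (\<exists>a b. \<not> int p dvd b \<and> x = of_int a / of_int b)"
proof
  assume "x \<in> Zp"
  then show "\<exists>a b. \<not> int p dvd b \<and> x = of_int a / of_int b"
    unfolding p_integral_def
    by (metis (mono_tags, lifting) mem_Collect_eq prod.collapse quotient_of_div)
next
  assume "\<exists>a b. \<not> int p dvd b \<and> x = of_int a / of_int b"
  then obtain a b where ab: "\<not> int p dvd b" "x = of_int a / of_int b" by blast
  obtain c d where cd: "quotient_of x = (c, d)" by fastforce
  then have d: "d > 0" "coprime c d" "x = of_int c / of_int d"
    using quotient_of_denom_pos quotient_of_coprime quotient_of_div by blast+
  have "b \<noteq> 0" using ab(1) by auto
  with ab d have "(of_int c * of_int b :: rat) = of_int a * of_int d"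
    by (simp add: field_simps)
  then have "c * b = a * d" by (metis of_int_eq_iff of_int_mult)
  then have "d dvd b" using d(2) by (metis coprime_commute coprime_dvd_mult_right_iff dvd_triv_right)
  then show "x \<in> Zp" using ab(1) cd by (auto simp: p_integral_def dest: dvd_trans)
qed

lemma Zp_int [simp, intro]: "of_int a \<in> Zp"
  unfolding Zp_iff using prime_int_p
  by (intro exI[of _ a] exI[of _ 1]) (auto simp: not_prime_unit)

lemma Zp_nat [simp, intro]: "of_nat a \<in> Zp"
  using Zp_int[of "int a"] by simp

lemma Zp_0 [simp, intro]: "0 \<in> Zp" and Zp_1 [simp, intro]: "1 \<in> Zp"
  and Zp_numeral [simp, intro]: "numeral n \<in> Zp"
  using Zp_nat[of 0] Zp_nat[of 1] Zp_nat[of "numeral n"] by simp_all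

lemma Zp_mult [intro]:
  assumes "x \<in> Zp" "y \<in> Zp" shows "x * y \<in> Zp"
proof -
  obtain a b c d where *: "\<not> int p dvd b" "x = of_int a / of_int b"
      "\<not> int p dvd d" "y = of_int c / of_int d"
    using assms unfolding Zp_iff by blast
  then have "x * y = of_int (a * c) / of_int (b * d)" by simp
  then show ?thesis using * prime_dvd_multD[OF prime_int_p] unfolding Zp_iff by blast
qed

lemma Zp_uminus [intro]: "x \<in> Zp \<Longrightarrow> - x \<in> Zp"
  using Zp_mult[of "of_int (-1)" x] Zp_int[of "-1"] by simp

lemma Zp_add [intro]:
  assumes "x \<in> Zp" "y \<in> Zp" shows "x + y \<in> Zp"
proof -
  obtain a b c d where *: "\<not> int p dvd b" "x = of_int a / of_int b"
      "\<not> int p dvd d" "y = of_int c / of_int d"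
    using assms unfolding Zp_iff by blast
  then have "b \<noteq> 0" "d \<noteq> 0" by auto
  with * have "x + y = of_int (a * d + c * b) / of_int (b * d)" by (simp add: field_simps)
  then show ?thesis using * prime_dvd_multD[OF prime_int_p] unfolding Zp_iff by blast
qed

lemma Zp_diff [intro]: "x \<in> Zp \<Longrightarrow> y \<in> Zp \<Longrightarrow> x - y \<in> Zp"
  using Zp_add[of x "- y"] Zp_uminus[of y] by simp

lemma Zp_power [intro]: "x \<in> Zp \<Longrightarrow> x ^ n \<in> Zp"
  by (induction n) (auto intro: Zp_mult)

lemma Zp_sum [intro]: "(\<And>i. i \<in> I \<Longrightarrow> f i \<in> Zp) \<Longrightarrow> sum f I \<in> Zp"
  by (induction I rule: infinite_finite_induct) (auto intro: Zp_add)

lemma Zp_prod [intro]: "(\<And>i. i \<in> I \<Longrightarrow> f i \<in> Zp) \<Longrightarrow> prod f I \<in> Zp"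
  by (induction I rule: infinite_finite_induct) (auto intro: Zp_mult)

lemma Zp_div_int [intro]:
  assumes "x \<in> Zp" "\<not> int p dvd b" shows "x / of_int b \<in> Zp"
proof -
  have "1 / of_int b \<in> Zp" using assms(2) unfolding Zp_iff by (intro exI[of _ 1] exI[of _ b]) simp
  from Zp_mult[OF assms(1) this] show ?thesis by simp
qed

lemma Zp_div_nat [intro]: "x \<in> Zp \<Longrightarrow> \<not> p dvd b \<Longrightarrow> x / of_nat b \<in> Zp"
  using Zp_div_int[of x "int b"] by simp

lemma pcong_Zp: "x \<approx>[e] y \<Longrightarrow> x \<in> Zp" "x \<approx>[e] y \<Longrightarrow> y \<in> Zp"
  by (auto simp: cong_p_integral_def)

lemma pcongI: "x \<in> Zp \<Longrightarrow> y \<in> Zp \<Longrightarrow> z \<in> Zp \<Longrightarrow> x - y = of_nat p ^ e * z \<Longrightarrow> x \<approx>[e] y"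
  by (auto simp: cong_p_integral_def)

lemma pcongE:
  assumes "x \<approx>[e] y"
  obtains z where "z \<in> Zp" "x = y + of_nat p ^ e * z"
  using assms by (auto simp: cong_p_integral_def algebra_simps)

lemma pcong_refl: "x \<in> Zp \<Longrightarrow> x \<approx>[e] x"
  by (rule pcongI[of _ _ 0]) auto

lemma pcong_sym: "x \<approx>[e] y \<Longrightarrow> y \<approx>[e] x"
  unfolding cong_p_integral_def by (metis Zp_uminus minus_diff_eq mult_minus_right)

lemma pcong_add:
  assumes "x \<approx>[e] y" "x' \<approx>[e] y'" shows "x + x' \<approx>[e] y + y'"
proof -
  obtain z z' where "z \<in> Zp" "x = y + of_nat p ^ e * z" "z' \<in> Zp" "x' = y' + of_nat p ^ e * z'"
    using assms by (meson pcongE)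
  then have "z + z' \<in> Zp" "(x + x') - (y + y') = of_nat p ^ e * (z + z')"
    using pcong_Zp[OF assms(1)] pcong_Zp[OF assms(2)] by (auto simp: algebra_simps)
  then show ?thesis using pcong_Zp[OF assms(1)] pcong_Zp[OF assms(2)] by (auto intro: pcongI)
qed

lemma pcong_mult:
  assumes "x \<approx>[e] y" "x' \<approx>[e] y'" shows "x * x' \<approx>[e] y * y'"
proof -
  obtain z z' where "z \<in> Zp" "x = y + of_nat p ^ e * z" "z' \<in> Zp" "x' = y' + of_nat p ^ e * z'"
    using assms by (meson pcongE)
  moreover from this have "z * x' + y * z' \<in> Zp"
    using pcong_Zp[OF assms(1)] pcong_Zp[OF assms(2)] by (intro Zp_add Zp_mult)
  ultimately show ?thesis using pcong_Zp[OF assms(1)] pcong_Zp[OF assms(2)]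
    by (intro pcongI[of _ _ "z * x' + y * z'"] Zp_mult) (simp_all add: algebra_simps)
qed

lemma pcong_trans [trans]:
  assumes "x \<approx>[e] y" "y \<approx>[e] z" shows "x \<approx>[e] z"
proof -
  obtain u v where "u \<in> Zp" "x = y + of_nat p ^ e * u" "v \<in> Zp" "y = z + of_nat p ^ e * v"
    using assms by (meson pcongE)
  then have "u + v \<in> Zp" "x - z = of_nat p ^ e * (u + v)"
    using pcong_Zp[OF assms(1)] pcong_Zp[OF assms(2)] by (auto simp: algebra_simps)
  then show ?thesis using pcong_Zp[OF assms(1)] pcong_Zp[OF assms(2)] by (auto intro: pcongI)
qed

lemma pcong_uminus: "x \<approx>[e] y \<Longrightarrow> - x \<approx>[e] - y"
  using pcong_mult[of e "-1" "-1" x y] pcong_refl[of "-1" e] by (simp add: Zp_uminus)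

lemma pcong_diff: "x \<approx>[e] y \<Longrightarrow> x' \<approx>[e] y' \<Longrightarrow> x - x' \<approx>[e] y - y'"
  using pcong_add[of e x y "- x'" "- y'"] pcong_uminus[of e x' y'] by simp

lemma pcong_power: "x \<approx>[e] y \<Longrightarrow> x ^ n \<approx>[e] y ^ n"
  by (induction n) (auto intro: pcong_mult pcong_refl)

lemma pcong_sum: "(\<And>i. i \<in> I \<Longrightarrow> f i \<approx>[e] g i) \<Longrightarrow> sum f I \<approx>[e] sum g I"
  by (induction I rule: infinite_finite_induct) (auto intro: pcong_add pcong_refl)

lemma pcong_prod: "(\<And>i. i \<in> I \<Longrightarrow> f i \<approx>[e] g i) \<Longrightarrow> prod f I \<approx>[e] prod g I"
  by (induction I rule: infinite_finite_induct) (auto intro: pcong_mult pcong_refl)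

lemma pcong_div:
  assumes "x \<approx>[e] y" "1 / c \<in> Zp" shows "x / c \<approx>[e] y / c"
  using pcong_mult[OF assms(1) pcong_refl[OF assms(2)]] by simp

lemma pcong_cancel:
  assumes "c * x \<approx>[e] c * y" "1 / c \<in> Zp" "c \<noteq> 0" shows "x \<approx>[e] y"
  using pcong_mult[OF pcong_refl[OF assms(2)] assms(1)] assms(3) by simp

text \<open>A factor \<open>p\<close> gains one power of precision, so terms carrying it need only
  be known modulo \<open>p\<close>.\<close>

lemma pcong_p_mult:
  assumes "x \<approx>[1] y" shows "of_nat p * x \<approx>[2] of_nat p * y"
proof -
  obtain z where "z \<in> Zp" "x = y + of_nat p ^ 1 * z" using assms by (rule pcongE)
  then show ?thesis using pcong_Zp[OF assms]
    by (intro pcongI[of _ _ z]) (auto simp: algebra_simps power2_eq_square)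
qed

lemma pcong_weaken:
  assumes "x \<approx>[2] y" shows "x \<approx>[1] y"
proof -
  obtain z where "z \<in> Zp" "x = y + of_nat p ^ 2 * z" using assms by (rule pcongE)
  then show ?thesis using pcong_Zp[OF assms]
    by (intro pcongI[of _ _ "of_nat p * z"]) (auto simp: algebra_simps power2_eq_square)
qed

lemma pcong_of_int_iff: "of_int a \<approx>[e] of_int b \<longleftrightarrow> [a = b] (mod int p ^ e)"
proof
  assume "[a = b] (mod int p ^ e)"
  then obtain k where "a - b = int p ^ e * k" by (auto simp: cong_iff_dvd_diff)
  then have "(of_int a - of_int b :: rat) = of_int (int p ^ e * k)" by (metis of_int_diff)
  then show "of_int a \<approx>[e] of_int b" by (intro pcongI[of _ _ "of_int k"]) auto
next
  assume "of_int a \<approx>[e] of_int b"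
  then obtain z where z: "z \<in> Zp" "(of_int a :: rat) = of_int b + of_nat p ^ e * z" by (rule pcongE)
  obtain c d where cd: "\<not> int p dvd d" "z = of_int c / of_int d" using z unfolding Zp_iff by blast
  then have "d \<noteq> 0" by auto
  with z(2) cd have "(of_int ((a - b) * d) :: rat) = of_int (int p ^ e * c)"
    by (simp add: field_simps)
  then have "(a - b) * d = int p ^ e * c" using of_int_eq_iff by blast
  then have "int p ^ e dvd (a - b) * d" by simp
  moreover have "coprime (int p ^ e) d"
    using cd(1) prime_int_p by (simp add: prime_imp_coprime)
  ultimately show "[a = b] (mod int p ^ e)"
    by (simp add: cong_iff_dvd_diff coprime_dvd_mult_left_iff)
qed

end

section \<open>The partial fraction identity\<close>

text \<open>With rising factorials this is the hypergeometric term (1/3)_k (2/3)_k / k!^2.\<close>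

definition hyp_term :: "nat \<Rightarrow> rat" where
  "hyp_term k = of_nat (((2 * k) choose k) * ((3 * k) choose k)) / 27 ^ k"

text \<open>The coefficient of x^k in the shifted Legendre polynomial P_m(1 - 2 x).\<close>

definition leg_coeff :: "nat \<Rightarrow> nat \<Rightarrow> rat" where
  "leg_coeff m k = (- 1) ^ k * of_nat (m choose k) * of_nat ((m + k) choose k)"

lemma binomial_2_3_fact: "((2 * k) choose k) * ((3 * k) choose k) * fact k ^ 3 = (fact (3 * k) :: nat)"
proof -
  have "fact k * fact k * ((2 * k) choose k) = (fact (2 * k) :: nat)"
    using binomial_fact_lemma[of k "2 * k"] by simp
  moreover have "fact k * fact (2 * k) * ((3 * k) choose k) = (fact (3 * k) :: nat)"
    using binomial_fact_lemma[of k "3 * k"] by simp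
  moreover have "((2 * k) choose k) * ((3 * k) choose k) * fact k ^ 3
      = fact k * (fact k * fact k * ((2 * k) choose k)) * ((3 * k) choose k)"
    by (simp add: power3_eq_cube)
  ultimately show ?thesis by simp
qed

lemma fact_triple:
  "fact (3 * k) = 3 ^ k * fact k * (\<Prod>i<k. of_nat (3 * i + 1)) * (\<Prod>i<k. of_nat (3 * i + 2) :: 'a :: {comm_semiring_1, semiring_char_0})"
proof (induction k)
  case (Suc k)
  have "fact (3 * Suc k) = of_nat (3 * k + 3) * (of_nat (3 * k + 2) * (of_nat (3 * k + 1) * (fact (3 * k) :: 'a)))"
    by (simp add: numeral_3_eq_3 fact_Suc algebra_simps del: of_nat_Suc of_nat_mult of_nat_add)
  also have "of_nat (3 * k + 3) = (3 * of_nat (Suc k) :: 'a)" by (simp add: algebra_simps)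
  finally show ?case
    unfolding Suc by (simp add: fact_Suc ac_simps del: of_nat_Suc of_nat_mult of_nat_add)
qed simp

lemma hyp_term_fact: "hyp_term k = fact (3 * k) / (3 ^ k * fact k) ^ 3"
proof -
  have "of_nat (((2 * k) choose k) * ((3 * k) choose k)) * fact k ^ 3 = (fact (3 * k) :: rat)"
    by (metis binomial_2_3_fact of_nat_fact of_nat_mult of_nat_power)
  then have "of_nat (((2 * k) choose k) * ((3 * k) choose k)) = (fact (3 * k) / fact k ^ 3 :: rat)"
    by (simp add: field_simps)
  then show ?thesis
    by (simp add: hyp_term_def power_mult_distrib power_mult[symmetric] mult.commute[of _ 3] power_mult)
qed

lemma hyp_term_prod:
  "hyp_term k = (\<Prod>i<k. of_nat (3 * i + 1) * of_nat (3 * i + 2)) / (3 ^ k * fact k) ^ 2"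
  unfolding hyp_term_fact fact_triple[of k]
  by (simp add: prod.distrib power3_eq_cube power2_eq_square del: of_nat_Suc of_nat_mult of_nat_add)

text \<open>A factor 9 is put into each term so that the denominator matches
  \<open>hyp_term_prod\<close> and the numerators can be compared factor by factor.\<close>

lemma leg_coeff_prod:
  "leg_coeff m k = (\<Prod>i<k. (3 * of_nat i - 3 * of_nat m) * (3 * of_nat m + 3 * of_nat i + 3)) / (3 ^ k * fact k) ^ 2"
proof -
  have "(of_nat (m choose k) :: rat) = (\<Prod>i<k. of_nat m - of_nat i) / fact k"
    by (simp add: binomial_gbinomial gbinomial_prod_rev atLeast0LessThan)
  moreover have "(of_nat ((m + k) choose k) :: rat) = (\<Prod>i<k. of_nat m + 1 + of_nat i) / fact k"
    by (simp add: binomial_gbinomial gbinomial_pochhammer' pochhammer_prod atLeast0LessThan add_ac)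
  moreover have "(\<Prod>i<k. (3 * of_nat i - 3 * of_nat m) * (3 * of_nat m + 3 * of_nat i + 3) :: rat)
     = (\<Prod>i<k. (- 9) * ((of_nat m - of_nat i) * (of_nat m + 1 + of_nat i)))"
    by (intro prod.cong) (simp_all add: algebra_simps)
  moreover have "\<dots> = (- 9) ^ k * ((\<Prod>i<k. of_nat m - of_nat i) * (\<Prod>i<k. of_nat m + 1 + of_nat i))"
    by (simp only: prod.distrib prod_constant card_lessThan)
  moreover have "(- 9 :: rat) ^ k = (- 1) ^ k * (3 ^ k) ^ 2"
    by (simp add: power_mult_distrib[symmetric] power_mult[symmetric] mult.commute[of k] power_mult)
  ultimately show ?thesis
    unfolding leg_coeff_def by (simp add: power_mult_distrib power2_eq_square)
qed

text \<open>Negating the upper index of the second binomial gives a Vandermonde convolution with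
  upper entries \<open>- m\<close> and \<open>m\<close>, whose value is
  \<open>0 gchoose m\<close>.\<close>

lemma sum_binomial_alternating_shift:
  assumes "m > 0"
  shows "(\<Sum>k\<le>m. (- 1) ^ k * of_nat (m choose k) * of_nat ((m + k - 1) choose k)) = (0 :: rat)"
proof -
  have "(- 1) ^ k * of_nat (m choose k) * of_nat ((m + k - 1) choose k)
      = (of_nat m gchoose (m - k)) * ((- of_nat m) gchoose k :: rat)" if "k \<le> m" for k
  proof -
    have "(- of_nat m) gchoose k = (- 1) ^ k * (of_nat (m + k - 1) gchoose k :: rat)"
      using assms by (simp add: gbinomial_minus of_nat_diff)
    then show ?thesis
      using that by (simp add: binomial_gbinomial[symmetric] binomial_symmetric[of k m])
  qed
  then have "(\<Sum>k\<le>m. (- 1) ^ k * of_nat (m choose k) * of_nat ((m + k - 1) choose k))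
      = (\<Sum>k\<in>{0..m}. ((- of_nat m) gchoose k) * (of_nat m gchoose (m - k)) :: rat)"
    by (intro sum.cong) auto
  also have "\<dots> = (- of_nat m + of_nat m) gchoose m" by (rule gbinomial_Vandermonde)
  finally show ?thesis using assms by (cases m) (simp_all add: gbinomial_0_left)
qed

text \<open>The difference of \<open>(x + m + 1)\<close> times the sum for \<open>m + 1\<close> and \<open>(m + 1 - x)\<close> times
  the sum for \<open>m\<close> is free of \<open>x\<close>, since the denominators \<open>x + k\<close> cancel termwise.\<close>

lemma leg_coeff_partial_fractions:
  fixes x :: rat
  assumes "\<And>i. x + of_nat i \<noteq> 0"
  shows "(\<Sum>k\<le>m. leg_coeff m k / (x + of_nat k)) = (\<Prod>i<m. of_nat (Suc i) - x) / (\<Prod>i\<le>m. x + of_nat i)"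
proof (induction m)
  case 0
  then show ?case by (simp add: leg_coeff_def)
next
  case (Suc m)
  \<comment> \<open>After multiplication by \<open>Suc m\<close>, both
    \<open>leg_coeff (Suc m) k\<close> and \<open>leg_coeff m k\<close> are a linear factor times
    \<open>b k\<close>.\<close>
  define b :: "nat \<Rightarrow> rat" where "b k = (- 1) ^ k * of_nat (Suc m choose k) * of_nat ((Suc m + k - 1) choose k)" for k
  have b1: "of_nat (Suc m) * leg_coeff (Suc m) k = of_nat (Suc m + k) * b k" for k
  proof -
    have "Suc m * ((Suc m + k) choose k) = (Suc m + k) * ((Suc m + k - 1) choose k)"
      using binomial_absorb_comp[of "Suc m + k" k] by simp
    then have "of_nat (Suc m) * of_nat ((Suc m + k) choose k) = (of_nat (Suc m + k) * of_nat ((Suc m + k - 1) choose k) :: rat)"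
      by (metis of_nat_mult)
    moreover have "of_nat (Suc m) * leg_coeff (Suc m) k
        = (- 1) ^ k * of_nat (Suc m choose k) * (of_nat (Suc m) * of_nat ((Suc m + k) choose k))"
      unfolding leg_coeff_def by (simp only: mult_ac)
    ultimately show ?thesis unfolding b_def by (simp only: mult_ac)
  qed
  have b2: "of_nat (Suc m) * leg_coeff m k = (of_nat (Suc m) - of_nat k) * b k" if "k \<le> Suc m" for k
  proof -
    have "(Suc m - k) * (Suc m choose k) = Suc m * (m choose k)"
      using binomial_absorb_comp[of "Suc m" k] by simp
    then have "(of_nat (Suc m) - of_nat k) * of_nat (Suc m choose k) = (of_nat (Suc m) * of_nat (m choose k) :: rat)"
      by (metis of_nat_mult of_nat_diff that)
    then show ?thesis unfolding leg_coeff_def b_def by (simp add: mult_ac)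
  qed
  have step: "(x + of_nat (Suc m)) * (leg_coeff (Suc m) k / (x + of_nat k))
      - (of_nat (Suc m) - x) * (leg_coeff m k / (x + of_nat k)) = 2 * b k" if "k \<le> Suc m" for k
  proof -
    have "of_nat (Suc m) * ((x + of_nat (Suc m)) * leg_coeff (Suc m) k - (of_nat (Suc m) - x) * leg_coeff m k)
        = (x + of_nat (Suc m)) * (of_nat (Suc m + k) * b k) - (of_nat (Suc m) - x) * ((of_nat (Suc m) - of_nat k) * b k)"
      unfolding b1[symmetric] b2[OF that, symmetric] by (simp add: algebra_simps)
    also have "\<dots> = of_nat (Suc m) * (2 * b k * (x + of_nat k))"
      by (simp add: algebra_simps)
    finally have "(x + of_nat (Suc m)) * leg_coeff (Suc m) k - (of_nat (Suc m) - x) * leg_coeff m k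
        = 2 * b k * (x + of_nat k)"
      by (subst (asm) mult_cancel_left) (use of_nat_neq_0 in blast)
    then have "((x + of_nat (Suc m)) * leg_coeff (Suc m) k - (of_nat (Suc m) - x) * leg_coeff m k) / (x + of_nat k)
        = 2 * b k"
      using assms[of k] by (simp only: nonzero_mult_div_cancel_right not_False_eq_True)
    then show ?thesis by (simp only: diff_divide_distrib times_divide_eq_right)
  qed
  have "(x + of_nat (Suc m)) * (\<Sum>k\<le>Suc m. leg_coeff (Suc m) k / (x + of_nat k))
      - (of_nat (Suc m) - x) * (\<Sum>k\<le>Suc m. leg_coeff m k / (x + of_nat k)) = (\<Sum>k\<le>Suc m. 2 * b k)"
    unfolding sum_distrib_left sum_subtractf[symmetric] by (intro sum.cong step) simp_all
  also have "\<dots> = 2 * (\<Sum>k\<le>Suc m. b k)" by (simp only: sum_distrib_left)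
  also have "(\<Sum>k\<le>Suc m. b k) = 0"
    unfolding b_def by (rule sum_binomial_alternating_shift) simp
  \<comment> \<open>The extra term \<open>k = Suc m\<close> is zero because
    \<open>m choose Suc m\<close> is.\<close>
  also have "(\<Sum>k\<le>Suc m. leg_coeff m k / (x + of_nat k)) = (\<Prod>i<m. of_nat (Suc i) - x) / (\<Prod>i\<le>m. x + of_nat i)"
    using Suc by (simp add: leg_coeff_def)
  finally have "(x + of_nat (Suc m)) * (\<Sum>k\<le>Suc m. leg_coeff (Suc m) k / (x + of_nat k))
      = (of_nat (Suc m) - x) * ((\<Prod>i<m. of_nat (Suc i) - x) / (\<Prod>i\<le>m. x + of_nat i))" by simp
  then have "(\<Sum>k\<le>Suc m. leg_coeff (Suc m) k / (x + of_nat k))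
      = (of_nat (Suc m) - x) * ((\<Prod>i<m. of_nat (Suc i) - x) / (\<Prod>i\<le>m. x + of_nat i)) / (x + of_nat (Suc m))"
    using assms[of "Suc m"] nonzero_mult_div_cancel_left by (metis (no_types, lifting))
  then show ?case by (simp add: mult_ac)
qed

text \<open>Partial fractions at \<open>x = 1 / 3\<close>. There are \<open>m\<close> factors above
  and \<open>m + 1\<close> below, so clearing thirds leaves a single 3, which cancels the one from
  \<open>x + k = (3 * k + 1) / 3\<close>.\<close>

lemma leg_coeff_sum_third:
  "(\<Sum>k\<le>m. leg_coeff m k / of_nat (3 * k + 1)) = (\<Prod>i<m. of_nat (3 * i + 2)) / (\<Prod>i\<le>m. of_nat (3 * i + 1))"
proof -
  have nz: "(1 / 3 :: rat) + of_nat i \<noteq> 0" for i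
    by (metis add_pos_nonneg less_numeral_extra(3) of_nat_0_le_iff zero_less_divide_1_iff zero_less_numeral)
  have "(\<Sum>k\<le>m. leg_coeff m k / of_nat (3 * k + 1)) = (\<Sum>k\<le>m. leg_coeff m k / (1 / 3 + of_nat k)) / 3"
    unfolding sum_divide_distrib by (intro sum.cong) (simp_all add: field_simps)
  also have "\<dots> = (\<Prod>i<m. of_nat (Suc i) - 1 / 3) / (\<Prod>i\<le>m. 1 / 3 + of_nat i) / 3"
    using leg_coeff_partial_fractions[OF nz] by simp
  also have "(\<Prod>i<m. of_nat (Suc i) - 1 / 3) = (\<Prod>i<m. of_nat (3 * i + 2) / 3 :: rat)"
    by (intro prod.cong) (simp_all add: field_simps)
  also have "(\<Prod>i\<le>m. 1 / 3 + of_nat i) = (\<Prod>i\<le>m. of_nat (3 * i + 1) / 3 :: rat)"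
    by (intro prod.cong) (simp_all add: field_simps)
  finally show ?thesis by (simp add: prod_dividef)
qed

section \<open>Reduction to a quotient of products\<close>

context prime_local
begin

section \<open>First-order expansions modulo p^2\<close>

lemma Zp_inverse_fact:
  assumes "k < p" shows "1 / fact k \<in> Zp"
  using Zp_div_nat[of 1 "fact k"] prime_dvd_fact_iff[OF prime_p, of k] assms by simp

lemma Zp_inverse_power: "1 / x \<in> Zp \<Longrightarrow> 1 / x ^ n \<in> Zp"
  using Zp_power[of "1 / x" n] by (simp add: power_divide)

lemma Zp_inverse_mult: "1 / x \<in> Zp \<Longrightarrow> 1 / y \<in> Zp \<Longrightarrow> 1 / (x * y) \<in> Zp"
  using Zp_mult[of "1 / x" "1 / y"] by simp

lemma Zp_inverse_less:
  assumes "0 < k" "k < p" shows "1 / of_nat k \<in> Zp"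
  using assms by (intro Zp_div_nat) (auto dest: dvd_imp_le)

lemma pcong_prod_one_minus:
  assumes "finite I" "\<And>i. i \<in> I \<Longrightarrow> y i \<in> Zp"
  shows "(\<Prod>i\<in>I. 1 - of_nat p * y i) \<approx>[2] 1 - of_nat p * (\<Sum>i\<in>I. y i)"
  using assms
proof (induction I rule: finite_induct)
  case (insert j I)
  let ?s = "\<Sum>i\<in>I. y i"
  have s: "?s \<in> Zp" "y j \<in> Zp" using insert.prems by auto
  have "(1 - of_nat p * y j) * (\<Prod>i\<in>I. 1 - of_nat p * y i) \<approx>[2] (1 - of_nat p * y j) * (1 - of_nat p * ?s)"
    using insert s by (intro pcong_mult pcong_refl Zp_diff Zp_mult) auto
  also have "\<dots> \<approx>[2] 1 - of_nat p * (y j + ?s)"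
    using s by (intro pcongI[of _ _ "y j * ?s"] Zp_diff Zp_mult Zp_add)
      (auto simp: algebra_simps power2_eq_square)
  finally show ?case using insert by simp
qed (auto intro: pcong_refl)

text \<open>The binomial is exactly the product of \<open>p / i - 1\<close> over
  \<open>i = 1..k\<close>, which is then expanded to first order in \<open>p\<close>.\<close>

lemma binomial_p_minus_1:
  assumes "k < p" shows "of_nat ((p - 1) choose k) \<approx>[2] (- 1) ^ k * (1 - of_nat p * (\<Sum>i=1..k. 1 / of_nat i))"
proof -
  have "(of_nat ((p - 1) choose k) :: rat) = (\<Prod>i\<in>{1..k}. of_nat p / of_nat i - 1)"
    using assms
  proof (induction k)
    case (Suc k)
    have "Suc k * ((p - 1) choose Suc k) = (p - Suc k) * ((p - 1) choose k)"
      using Suc.prems binomial_absorption[of k "p - 1"] binomial_absorb_comp[of "p - 1" k] by simp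
    then have "of_nat (Suc k) * of_nat ((p - 1) choose Suc k) = (of_nat p - of_nat (Suc k)) * (of_nat ((p - 1) choose k) :: rat)"
      using Suc.prems by (metis of_nat_diff of_nat_mult less_imp_le)
    then have "of_nat ((p - 1) choose Suc k) = (of_nat p - of_nat (Suc k)) * (of_nat ((p - 1) choose k) :: rat) / of_nat (Suc k)"
      by (metis nonzero_mult_div_cancel_left of_nat_neq_0)
    also have "\<dots> = of_nat ((p - 1) choose k) * (of_nat p / of_nat (Suc k) - 1)"
    proof -
      have "(A - B) * c / B = c * (A / B - 1)" if "B \<noteq> 0" for A B c :: rat
        using that by (simp add: field_simps)
      then show ?thesis using of_nat_neq_0 by blast
    qed
    also have "of_nat ((p - 1) choose k) = (\<Prod>i\<in>{1..k}. of_nat p / of_nat i - 1 :: rat)"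
      using Suc by simp
    finally show ?case by simp
  qed simp
  also have "\<dots> = (\<Prod>i\<in>{1..k}. - 1 * (1 - of_nat p * (1 / of_nat i)))"
    by (intro prod.cong) auto
  also have "\<dots> = (- 1) ^ k * (\<Prod>i\<in>{1..k}. 1 - of_nat p * (1 / of_nat i))"
    by (simp only: prod.distrib prod_constant card_atLeastAtMost) simp
  also have "\<dots> \<approx>[2] (- 1) ^ k * (1 - of_nat p * (\<Sum>i=1..k. 1 / of_nat i))"
    using assms by (intro pcong_mult pcong_prod_one_minus pcong_refl Zp_power Zp_uminus Zp_inverse_less) auto
  finally show ?thesis .
qed

lemma binomial_p_minus_1_mod_p:
  assumes "k < p" shows "of_nat ((p - 1) choose k) \<approx>[1] (- 1) ^ k"
proof -
  let ?H = "\<Sum>i=1..k. 1 / of_nat i :: rat"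
  have H: "?H \<in> Zp" using assms by (intro Zp_sum Zp_inverse_less) auto
  have "of_nat ((p - 1) choose k) \<approx>[1] (- 1) ^ k * (1 - of_nat p * ?H)"
    using binomial_p_minus_1[OF assms] by (rule pcong_weaken)
  also have "\<dots> \<approx>[1] (- 1) ^ k * 1"
    using H by (intro pcong_mult pcong_refl pcongI[of "1 - of_nat p * ?H" 1 "- ?H"] Zp_power Zp_uminus Zp_diff Zp_mult) auto
  finally show ?thesis by simp
qed

end

locale prime_gt3 = prime_local +
  assumes p_gt3: "p > 3"
begin

lemma not_p_dvd_small: "0 < k \<Longrightarrow> k \<le> 3 \<Longrightarrow> \<not> p dvd k"
  using p_gt3 by (auto dest: dvd_imp_le)

lemma Zp_third [simp, intro]: "1 / 3 \<in> Zp" and Zp_half [simp, intro]: "1 / 2 \<in> Zp"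
  using Zp_inverse_less[of 3] Zp_inverse_less[of 2] p_gt3 by simp_all

lemma Zp_inverse_27: "1 / 27 ^ k \<in> Zp"
  using Zp_power[OF Zp_third, of "3 * k"] by (simp add: power_mult power_divide)

lemma hyp_term_Zp [intro]: "hyp_term k \<in> Zp"
  using Zp_mult[OF Zp_nat[of "((2 * k) choose k) * ((3 * k) choose k)"] Zp_inverse_27[of k]] by (simp add: hyp_term_def)

lemma odd_p: "odd p"
  using prime_p p_gt3 prime_odd_nat by simp

lemma not_3_dvd_p: "\<not> 3 dvd p"
  using prime_p p_gt3 primes_dvd_imp_eq[of 3 p] by auto

section \<open>The left-hand side as a sum over k\<close>

lemma W_quotient:
  "of_int (W n) / (- 3) ^ n
     = (\<Sum>k = 0..n div 3. of_nat (((2 * k) choose k) * ((3 * k) choose k)) * of_nat (n choose (3 * k)) / (- 27 :: rat) ^ k)"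
  unfolding W_def of_int_sum sum_divide_distrib
proof (intro sum.cong refl)
  fix k assume "k \<in> {0..n div 3}"
  then have "3 * k \<le> n" by auto
  then have "(- 3 :: rat) ^ n = (- 3) ^ (n - 3 * k) * (- 3) ^ (3 * k)"
    by (simp add: power_add[symmetric])
  also have "(- 3 :: rat) ^ (3 * k) = (- 27) ^ k" by (simp add: power_mult)
  finally show "of_int (int ((2 * k) choose k) * int ((3 * k) choose k) * int (n choose (3 * k)) * (- 3) ^ (n - 3 * k)) / (- 3) ^ n
      = of_nat (((2 * k) choose k) * ((3 * k) choose k)) * of_nat (n choose (3 * k)) / (- 27 :: rat) ^ k"
    by simp
qed

text \<open>After interchanging the sums, the inner sum over \<open>n\<close> is a hockey-stick sum.
  The range of \<open>k\<close> can be made independent of \<open>n\<close> since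
  \<open>n choose (3 * k)\<close> vanishes for \<open>3 * k > n\<close>.\<close>

lemma sum_W_quotient:
  "(\<Sum>n = 0..p - 1. of_int (W n) / (- 3) ^ n)
     = (\<Sum>k = 0..p div 3. of_nat (((2 * k) choose k) * ((3 * k) choose k)) * of_nat (p choose (3 * k + 1)) / (- 27 :: rat) ^ k)"
proof -
  define f where "f k = (of_nat (((2 * k) choose k) * ((3 * k) choose k)) / (- 27) ^ k :: rat)" for k
  have "of_int (W n) / (- 3) ^ n = (\<Sum>k = 0..p div 3. f k * of_nat (n choose (3 * k)))" if "n \<le> p - 1" for n
    unfolding W_quotient f_def
  proof (rule sum.mono_neutral_cong_left)
    show "{0..n div 3} \<subseteq> {0..p div 3}" using that by (auto intro: order_trans div_le_mono)
    show "\<forall>i\<in>{0..p div 3} - {0..n div 3}.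
        of_nat ((2 * i choose i) * (3 * i choose i)) / (- 27) ^ i * of_nat (n choose (3 * i)) = (0 :: rat)"
      by (auto intro!: binomial_eq_0)
  qed auto
  then have "(\<Sum>n = 0..p - 1. of_int (W n) / (- 3) ^ n) = (\<Sum>n = 0..p - 1. \<Sum>k = 0..p div 3. f k * of_nat (n choose (3 * k)))"
    by (intro sum.cong) auto
  also have "\<dots> = (\<Sum>k = 0..p div 3. f k * of_nat (\<Sum>n = 0..p - 1. n choose (3 * k)))"
    by (subst sum.swap) (simp add: sum_distrib_left)
  also have "\<dots> = (\<Sum>k = 0..p div 3. f k * of_nat (p choose (3 * k + 1)))"
  proof (intro sum.cong refl)
    fix k
    have "(\<Sum>n = 0..p - 1. n choose (3 * k)) = p choose (3 * k + 1)"
      using sum_choose_upper[of "3 * k" "p - 1"] p_gt3 by (simp add: atMost_atLeast0)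
    then show "f k * of_nat (\<Sum>n = 0..p - 1. n choose (3 * k)) = f k * of_nat (p choose (3 * k + 1))" by simp
  qed
  finally show ?thesis by (simp add: f_def)
qed

lemma sum_W_cong:
  "(\<Sum>n = 0..p - 1. of_int (W n) / (- 3) ^ n)
     \<approx>[2] (\<Sum>k = 0..p div 3. hyp_term k * (of_nat p / of_nat (3 * k + 1)))"
  unfolding sum_W_quotient
proof (intro pcong_sum)
  fix k assume k: "k \<in> {0..p div 3}"
  define d :: rat where "d = of_nat (3 * k + 1)"
  have [simp]: "d \<noteq> 0" unfolding d_def by (simp del: of_nat_Suc)
  have "(3 * k + 1) * (p choose (3 * k + 1)) = p * ((p - 1) choose (3 * k))"
    using binomial_absorption[of "3 * k" p] by simp
  then have "d * of_nat (p choose (3 * k + 1)) = of_nat p * of_nat ((p - 1) choose (3 * k))"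
    unfolding d_def by (metis of_nat_mult)
  then have b: "of_nat (p choose (3 * k + 1)) = of_nat p * of_nat ((p - 1) choose (3 * k)) / d"
    by (simp add: field_simps)
  have e: "(- 27 :: rat) ^ k = (- 1) ^ k * 27 ^ k" by (rule power_minus)
  have t: "of_nat (((2 * k) choose k) * ((3 * k) choose k)) * of_nat (p choose (3 * k + 1)) / (- 27 :: rat) ^ k
     = hyp_term k * (of_nat p * (- 1) ^ k * of_nat ((p - 1) choose (3 * k)) / d)"
  proof -
    have "a * (q * B / d) / (s * c) = a / c * (q * s * B / d)" if "s = 1 \<or> s = - 1" for a q B s c :: rat
      using that by auto
    moreover have "(- 1 :: rat) ^ k = 1 \<or> (- 1 :: rat) ^ k = - 1" by (cases "even k") simp_all
    ultimately show ?thesis unfolding b hyp_term_def e by blast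
  qed
  have "of_nat p * (- 1) ^ k * of_nat ((p - 1) choose (3 * k)) / d \<approx>[2] of_nat p / d"
  proof (cases "3 * k + 1 = p")
    \<comment> \<open>Here \<open>p / (3 * k + 1)\<close> carries no factor \<open>p\<close>, but
      both sides equal 1 exactly, with positive sign because \<open>k\<close> is even.\<close>
    case True
    then have "even k" using odd_p by presburger
    moreover have "of_nat p = d" "p - 1 = 3 * k" using True by (auto simp: d_def)
    ultimately show ?thesis using pcong_refl[OF Zp_1] by simp
  next
    case False
    \<comment> \<open>The range of \<open>k\<close> only gives \<open>3 * k + 1 \<le> p + 1\<close>;
      the value \<open>p + 1\<close> would make 3 divide \<open>p\<close>.\<close>
    have "3 * k + 1 \<noteq> p + 1" using not_3_dvd_p by auto
    then have less: "3 * k + 1 < p" using False k by auto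
    then have d: "1 / d \<in> Zp" unfolding d_def by (intro Zp_inverse_less) auto
    have "(- 1) ^ k * of_nat ((p - 1) choose (3 * k)) / d \<approx>[1] (- 1) ^ k * (- 1) ^ (3 * k) / d"
      using less d by (intro pcong_div pcong_mult pcong_refl binomial_p_minus_1_mod_p Zp_power Zp_uminus) auto
    also have "(- 1 :: rat) ^ k * (- 1) ^ (3 * k) = 1" by (simp add: power_add[symmetric])
    finally have "of_nat p * ((- 1) ^ k * of_nat ((p - 1) choose (3 * k)) / d) \<approx>[2] of_nat p * (1 / d)"
      by (rule pcong_p_mult)
    then show ?thesis by (simp add: mult.assoc)
  qed
  then show "of_nat (((2 * k) choose k) * ((3 * k) choose k)) * of_nat (p choose (3 * k + 1)) / (- 27 :: rat) ^ k
     \<approx>[2] hyp_term k * (of_nat p / of_nat (3 * k + 1))"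
    unfolding t d_def[symmetric] by (intro pcong_mult pcong_refl hyp_term_Zp)
qed

lemma Zp_inverse_3_fact: "k < p \<Longrightarrow> 1 / (3 ^ k * fact k) \<in> Zp"
  by (intro Zp_inverse_mult Zp_inverse_power Zp_inverse_fact) auto

text \<open>Corresponding factors of the numerators differ by
  \<open>(3 * m + 1) * (3 * m + 2)\<close>, a multiple of \<open>p\<close> in either residue
  class.\<close>

lemma hyp_term_cong_leg_coeff:
  assumes "k < p" "p = 3 * m + 1 \<or> p = 3 * m + 2"
  shows "hyp_term k \<approx>[1] leg_coeff m k"
  unfolding hyp_term_prod leg_coeff_prod
proof (intro pcong_div pcong_prod)
  fix i
  have "int ((3 * i + 1) * (3 * i + 2)) - (3 * int i - 3 * int m) * (3 * int m + 3 * int i + 3)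
      = int p * (int (if p = 3 * m + 1 then 3 * m + 2 else 3 * m + 1))"
    using assms(2) by (auto simp: algebra_simps)
  then have "[int ((3 * i + 1) * (3 * i + 2)) = (3 * int i - 3 * int m) * (3 * int m + 3 * int i + 3)] (mod int p ^ 1)"
    by (simp add: cong_iff_dvd_diff)
  from this[folded pcong_of_int_iff]
  show "of_nat (3 * i + 1) * of_nat (3 * i + 2) \<approx>[1] (3 * of_nat i - 3 * of_nat m) * (3 * of_nat m + 3 * of_nat i + 3)"
    by (simp add: algebra_simps)
qed (use assms in \<open>intro Zp_inverse_power Zp_inverse_3_fact\<close>)

lemma sum_cong_leg:
  assumes "\<And>k. k \<in> I \<Longrightarrow> 3 * k + 1 < p" "p = 3 * m + 1 \<or> p = 3 * m + 2"
  shows "(\<Sum>k\<in>I. hyp_term k * (of_nat p / of_nat (3 * k + 1)))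
     \<approx>[2] of_nat p * (\<Sum>k\<in>I. leg_coeff m k / of_nat (3 * k + 1))"
proof -
  have "of_nat p * (\<Sum>k\<in>I. hyp_term k / of_nat (3 * k + 1)) \<approx>[2] of_nat p * (\<Sum>k\<in>I. leg_coeff m k / of_nat (3 * k + 1))"
    using assms(1) by (intro pcong_p_mult pcong_sum pcong_div hyp_term_cong_leg_coeff assms(2) Zp_inverse_less) force+
  also have "of_nat p * (\<Sum>k\<in>I. hyp_term k / of_nat (3 * k + 1)) = (\<Sum>k\<in>I. hyp_term k * (of_nat p / of_nat (3 * k + 1)))"
    unfolding sum_distrib_left by (intro sum.cong) (simp_all del: of_nat_Suc of_nat_add)
  finally show ?thesis .
qed

section \<open>The case of p congruent to 2 modulo 3\<close>

lemma fermat_3: "3 ^ (p - 1) \<approx>[1] 1"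
proof -
  have "[3 ^ (p - 1) = 1] (mod p)"
    using prime_p not_p_dvd_small[of 3] by (intro fermat_theorem) auto
  then have "[int (3 ^ (p - 1)) = int 1] (mod int p)" by (simp only: cong_int_iff)
  then show ?thesis using pcong_of_int_iff[of 1 "3 ^ (p - 1)" 1] by simp
qed

text \<open>Partial fractions turn the sum into \<open>p * (P / Q)\<close>. Modulo \<open>p\<close>,
  Wilson gives \<open>X * P * Q = - 1\<close> and reflection gives \<open>P = (- 1) ^ m * X\<close>,
  so \<open>P / Q\<close> is \<open>- X ^ 3\<close>, where
  \<open>X ^ 3 = 3 ^ (p - 1) * fact m ^ 3 / 3\<close>.\<close>

lemma sum_cong_2_mod_3:
  assumes p: "p = 3 * m + 2"
  shows "(\<Sum>k = 0..m. hyp_term k * (of_nat p / of_nat (3 * k + 1))) \<approx>[2] - (of_nat p / 3) * fact m ^ 3"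
proof -
  define P Q X :: rat where "P = (\<Prod>i<m. of_nat (3 * i + 2))" and "Q = (\<Prod>i\<le>m. of_nat (3 * i + 1))"
    and "X = 3 ^ m * fact m"
  have Q: "Q = (\<Prod>i<m. of_nat (3 * i + 1)) * of_nat (3 * m + 1)"
    unfolding Q_def by (simp add: lessThan_Suc_atMost[symmetric] del: of_nat_Suc)
  have "fact (p - 1) = of_nat (3 * m + 1) * (fact (3 * m) :: rat)"
    using p by (simp add: fact_Suc)
  also have "\<dots> = X * P * Q"
    unfolding fact_triple[of m] Q P_def X_def by (simp only: mult_ac)
  finally have f: "fact (p - 1) = X * P * Q" .
  have w: "X * P * Q \<approx>[1] - 1"
  proof -
    have "[fact (p - 1) = - 1] (mod int p ^ 1)" using wilson_theorem[OF prime_p] by simp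
    from this[folded pcong_of_int_iff] show ?thesis unfolding f[symmetric] by simp
  qed
  have P: "P \<approx>[1] (- 1) ^ m * X"
  proof -
    \<comment> \<open>This is \<open>3 * i + 2 = p - 3 * (m - i)\<close>, with \<open>m - i\<close>
      written as \<open>Suc (m - Suc i)\<close> to suit the reversal of the product.\<close>
    have "(\<Prod>i<m. of_nat (3 * i + 2)) \<approx>[1] (\<Prod>i<m. - 3 * of_nat (Suc (m - Suc i)))"
    proof (rule pcong_prod)
      fix i assume "i \<in> {..<m}"
      then have "int (3 * i + 2) - (- 3 * int (Suc (m - Suc i))) = int p ^ 1"
        using p by (auto simp: of_nat_diff)
      then have "[int (3 * i + 2) = - 3 * int (Suc (m - Suc i))] (mod int p ^ 1)"
        by (simp add: cong_iff_dvd_diff)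
      from this[folded pcong_of_int_iff]
      show "of_nat (3 * i + 2) \<approx>[1] - 3 * of_nat (Suc (m - Suc i))" by simp
    qed
    also have "(\<Prod>i<m. - 3 * of_nat (Suc (m - Suc i)) :: rat) = (\<Prod>i<m. - 3 * of_nat (Suc i))"
      by (rule prod.nat_diff_reindex)
    also have "\<dots> = (- 3) ^ m * fact m"
      by (simp only: prod.distrib prod_constant card_lessThan fact_prod_Suc of_nat_prod atLeast0LessThan)
    also have "(- 3 :: rat) ^ m = (- 1) ^ m * 3 ^ m" by (rule power_minus)
    finally show ?thesis by (simp add: P_def X_def mult.assoc)
  qed
  have Zp: "P \<in> Zp" "X \<in> Zp" "Q \<in> Zp"
    using Zp_nat[of "3 ^ m * fact m"] unfolding P_def X_def Q_def by auto
  have "X * P * Q \<noteq> 0" using f[symmetric] by simp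
  then have nz: "Q \<noteq> 0" "P \<noteq> 0" "X \<noteq> 0" by auto
  have iQ: "1 / Q \<in> Zp"
  proof -
    have "1 / fact (p - 1) \<in> Zp" using p_gt3 by (intro Zp_inverse_fact) simp
    from Zp_mult[OF this Zp_mult[OF Zp(2) Zp(1)]] show ?thesis using nz unfolding f by simp
  qed
  have "P / Q * - 1 \<approx>[1] P / Q * (X * P * Q)"
    using Zp by (intro pcong_mult pcong_refl pcong_sym[OF w]) (use Zp_mult[OF Zp(1) iQ] in simp)
  also have "P / Q * (X * P * Q) = X * P * P" using nz by simp
  also have "\<dots> \<approx>[1] X * ((- 1) ^ m * X) * ((- 1) ^ m * X)"
    using Zp by (intro pcong_mult P pcong_refl)
  also have "\<dots> = X ^ 3" by (simp add: power3_eq_cube power_add[symmetric] mult_2[symmetric])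
  also have "X ^ 3 = 3 ^ (p - 1) * (fact m ^ 3 / 3)"
    using p by (simp add: X_def power_mult_distrib power_mult[symmetric] mult.commute[of m])
  also have "\<dots> \<approx>[1] 1 * (fact m ^ 3 / 3)"
    using Zp_mult[OF Zp_power[OF Zp_nat[of "fact m"], of 3] Zp_third]
    by (intro pcong_mult fermat_3 pcong_refl) simp
  finally have "P / Q \<approx>[1] - (fact m ^ 3 / 3)" using pcong_uminus by fastforce
  from pcong_p_mult[OF this]
  have "of_nat p * (P / Q) \<approx>[2] - (of_nat p / 3) * fact m ^ 3" by simp
  moreover have "(\<Sum>k = 0..m. hyp_term k * (of_nat p / of_nat (3 * k + 1)))
     \<approx>[2] of_nat p * (\<Sum>k = 0..m. leg_coeff m k / of_nat (3 * k + 1))"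
    using p by (intro sum_cong_leg) auto
  ultimately show ?thesis
    unfolding atLeast0AtMost leg_coeff_sum_third P_def Q_def by (blast intro: pcong_trans)
qed

end

section \<open>Fermat quotients\<close>

lemma sum_split_mod_3:
  fixes g :: "nat \<Rightarrow> 'a :: comm_monoid_add"
  shows "(\<Sum>i\<in>{1..<3 * m + 1}. g i) = (\<Sum>s<m. g (3 * s + 1) + g (3 * s + 2) + g (3 * s + 3))"
proof (induction m)
  case (Suc m)
  have "{1..<3 * Suc m + 1} = {1..<3 * m + 1} \<union> {3 * m + 1, 3 * m + 2, 3 * m + 3}" by auto
  then have "(\<Sum>i\<in>{1..<3 * Suc m + 1}. g i) = (\<Sum>i\<in>{1..<3 * m + 1}. g i) + (g (3 * m + 1) + g (3 * m + 2) + g (3 * m + 3))"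
    by (simp only:) (subst sum.union_disjoint, auto simp: add_ac)
  then show ?case unfolding Suc by simp
qed simp

context prime_gt3
begin

text \<open>The coefficients of \<open>((1 - t) ^ p - 1 + t ^ p) / p\<close>.\<close>

definition fq :: "nat \<Rightarrow> int" where
  "fq i = (- 1) ^ i * int ((p choose i) div p)"

lemma p_dvd_choose: "0 < i \<Longrightarrow> i < p \<Longrightarrow> p dvd (p choose i)"
  using prime_p by (intro dvd_choose_prime) auto

lemma p_mult_fq: "0 < i \<Longrightarrow> i < p \<Longrightarrow> int p * fq i = (- 1) ^ i * int (p choose i)"
  using p_dvd_choose[of i] by (auto simp: fq_def)

lemma fq_reflect:
  assumes "0 < i" "i < p" shows "fq (p - i) = - fq i"
proof -
  have "(- 1 :: int) ^ (p - i) = - ((- 1) ^ i)"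
    using odd_p assms by (cases "even i") simp_all
  then show ?thesis using binomial_symmetric[of i p] assms by (simp add: fq_def)
qed

text \<open>\<open>p choose i\<close> is \<open>p / i\<close> times
  \<open>(p - 1) choose (i - 1)\<close>, and the signs \<open>(- 1) ^ i\<close> and
  \<open>(- 1) ^ (i - 1)\<close> multiply to -1.\<close>

lemma fq_pcong:
  assumes "0 < i" "i < p" shows "of_int (fq i) \<approx>[1] - (1 / of_nat i)"
proof -
  obtain j where j: "i = Suc j" using assms by (cases i) auto
  have "i * (p choose i) = p * ((p - 1) choose j)"
    using binomial_absorption[of j p] by (simp add: j)
  then have "of_nat i * of_nat (p choose i) = (of_nat p * of_nat ((p - 1) choose j) :: rat)"
    by (metis of_nat_mult)
  moreover have "of_nat p * of_int (fq i) = (- 1) ^ i * (of_nat (p choose i) :: rat)"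
    using arg_cong[OF p_mult_fq[OF assms], of "of_int :: int \<Rightarrow> rat"] by simp
  ultimately have "of_nat p * (of_nat i * of_int (fq i)) = of_nat p * ((- 1) ^ i * (of_nat ((p - 1) choose j) :: rat))"
    by (simp add: algebra_simps)
  then have "of_nat i * of_int (fq i) = (- 1) ^ i * (of_nat ((p - 1) choose j) :: rat)"
    using p_gt3 by simp
  also have "\<dots> \<approx>[1] (- 1) ^ i * (- 1) ^ j"
    using assms j by (intro pcong_mult pcong_refl binomial_p_minus_1_mod_p Zp_power Zp_uminus) auto
  also have "(- 1 :: rat) ^ i * (- 1) ^ j = of_nat i * (- (1 / of_nat i))"
    using assms j by (simp add: power_add[symmetric] mult_2[symmetric] del: of_nat_Suc)
  finally have "of_nat i * of_int (fq i) \<approx>[1] of_nat i * - (1 / of_nat i)" .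
  then show ?thesis
    by (rule pcong_cancel) (use assms in \<open>auto intro: Zp_inverse_less\<close>)
qed

definition Fq :: "int \<Rightarrow> int" where
  "Fq t = (\<Sum>i\<in>{1..<p}. fq i * t ^ i)"

text \<open>As \<open>p\<close> is odd, the binomial theorem gives
  \<open>1 - t ^ p + p * Fq t\<close> exactly; the hypothesis then replaces \<open>t ^ p\<close> by
  \<open>t\<close>.\<close>

lemma power_p_one_minus:
  assumes "[t ^ p = t] (mod int p ^ 2)"
  shows "[(1 - t) ^ p = 1 - t + int p * Fq t] (mod int p ^ 2)"
proof -
  have "{..p} = insert 0 (insert p {1..<p})" using p_gt3 by auto
  then have "(1 - t) ^ p = (\<Sum>i\<in>insert 0 (insert p {1..<p}). int (p choose i) * (- t) ^ i)"
    using binomial_ring[of "- t" 1 p] by simp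
  also have "\<dots> = 1 - t ^ p + (\<Sum>i\<in>{1..<p}. int (p choose i) * (- t) ^ i)"
    using p_gt3 odd_p by simp
  also have "(\<Sum>i\<in>{1..<p}. int (p choose i) * (- t) ^ i) = (\<Sum>i\<in>{1..<p}. int p * (fq i * t ^ i))"
  proof (intro sum.cong refl)
    fix i assume "i \<in> {1..<p}"
    then have "int p * fq i = (- 1) ^ i * int (p choose i)" by (intro p_mult_fq) auto
    then show "int (p choose i) * (- t) ^ i = int p * (fq i * t ^ i)"
      by (simp add: power_minus[of t] mult.assoc[symmetric])
  qed
  also have "\<dots> = int p * Fq t" by (simp add: Fq_def sum_distrib_left)
  finally show ?thesis
    using assms by (auto intro!: cong_add cong_diff)
qed

end

locale prime_1_mod_3 = prime_gt3 +
  fixes m :: nat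
  assumes p_eq: "p = 3 * m + 1"
begin

lemma even_m: "even m"
  using odd_p p_eq by simp

lemma m_pos: "0 < m"
  using p_eq p_gt3 by simp

definition H :: rat where "H = (\<Sum>i=1..m. 1 / of_nat i)"

lemma Zp_H [intro, simp]: "H \<in> Zp"
  unfolding H_def using p_eq by (intro Zp_sum Zp_inverse_less) auto

lemma coprime_p_imp_cancel:
  "\<not> int p dvd a \<Longrightarrow> [a * b = a * c] (mod int p ^ n) \<longleftrightarrow> [b = c] (mod int p ^ n)"
  using prime_imp_coprime[OF prime_int_p, of a] by (intro cong_mult_lcancel) (simp add: coprime_commute)

lemma cube_root_of_unity:
  assumes "[z ^ 2 + z + 1 = 0] (mod int p ^ 2)"
  shows "[z ^ (3 * k) = 1] (mod int p ^ 2)" "[z ^ p = z] (mod int p ^ 2)" "\<not> int p dvd z"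
proof -
  have "[(z - 1) * (z ^ 2 + z + 1) = (z - 1) * 0] (mod int p ^ 2)"
    using assms by (rule cong_scalar_left)
  then have "[z ^ 3 - 1 = 0] (mod int p ^ 2)"
    by (simp add: algebra_simps power2_eq_square power3_eq_cube)
  then have z3: "[z ^ 3 = 1] (mod int p ^ 2)" by (simp add: cong_iff_dvd_diff)
  then have *: "[z ^ (3 * k) = 1] (mod int p ^ 2)" for k
    using cong_pow[of "z ^ 3" 1 _ k] by (simp add: power_mult)
  then show "[z ^ (3 * k) = 1] (mod int p ^ 2)" .
  show "[z ^ p = z] (mod int p ^ 2)"
    using cong_scalar_left[OF *[of m], of z] by (simp add: p_eq)
  show "\<not> int p dvd z"
  proof
    assume "int p dvd z"
    then have "int p dvd z ^ 2 + z" by (simp add: power2_eq_square)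
    moreover have "int p dvd z ^ 2 + z + 1"
      using assms by (auto simp: cong_iff_dvd_diff power2_eq_square intro: dvd_mult_left)
    ultimately have "int p dvd 1" by (simp add: dvd_add_right_iff)
    then show False using p_gt3 by simp
  qed
qed

text \<open>Expand \<open>(1 - z) ^ p\<close> modulo \<open>p\<^sup>2\<close> and compare its square with \<open>(1 - z)\<^sup>2 = - 3 * z\<close>.\<close>

lemma power_3_cong_int:
  assumes "[z ^ 2 + z + 1 = 0] (mod int p ^ 2)"
  shows "[3 ^ (p - 1) = 1 + 2 * int p * (\<Sum>s<m. fq (3 * s + 3))] (mod int p ^ 2)"
proof -
  note z = cube_root_of_unity[OF assms]
  define A0 A1 A2 where "A0 = (\<Sum>s<m. fq (3 * s + 3))" and "A1 = (\<Sum>s<m. fq (3 * s + 1))"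
    and "A2 = (\<Sum>s<m. fq (3 * s + 2))"
  \<comment> \<open>As \<open>p\<close> is 1 modulo 3, reflecting \<open>i\<close> to
    \<open>p - i\<close> swaps the classes 0 and 1 modulo 3 and preserves the class 2. Since
    \<open>fq\<close> changes sign, \<open>A1 = - A0\<close> and \<open>A2 = 0\<close>.\<close>
  have "A0 = (\<Sum>s<m. - fq (3 * (m - Suc s) + 1))"
    unfolding A0_def
  proof (intro sum.cong refl)
    fix s assume "s \<in> {..<m}"
    then have "p - (3 * s + 3) = 3 * (m - Suc s) + 1" "3 * s + 3 < p" using p_eq by auto
    then show "fq (3 * s + 3) = - fq (3 * (m - Suc s) + 1)"
      using fq_reflect[of "3 * s + 3"] by simp
  qed
  also have "\<dots> = - A1"
    unfolding A1_def sum_negf using sum.nat_diff_reindex[of "\<lambda>s. fq (3 * s + 1)" m] by simp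
  finally have A1: "A1 = - A0" by simp
  have "A2 = (\<Sum>s<m. - fq (3 * (m - Suc s) + 2))"
    unfolding A2_def
  proof (intro sum.cong refl)
    fix s assume "s \<in> {..<m}"
    then have "p - (3 * s + 2) = 3 * (m - Suc s) + 2" "3 * s + 2 < p" using p_eq by auto
    then show "fq (3 * s + 2) = - fq (3 * (m - Suc s) + 2)"
      using fq_reflect[of "3 * s + 2"] by simp
  qed
  also have "\<dots> = - A2"
    unfolding A2_def sum_negf using sum.nat_diff_reindex[of "\<lambda>s. fq (3 * s + 2)" m] by simp
  finally have A2: "A2 = 0" by simp
  have F1: "Fq z = (\<Sum>s<m. fq (3 * s + 1) * z ^ (3 * s + 1) + fq (3 * s + 2) * z ^ (3 * s + 2) + fq (3 * s + 3) * z ^ (3 * s + 3))"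
    using sum_split_mod_3[of "\<lambda>i. fq i * z ^ i" m] unfolding p_eq[symmetric] Fq_def .
  have F2: "[(\<Sum>s<m. fq (3 * s + 1) * z ^ (3 * s + 1) + fq (3 * s + 2) * z ^ (3 * s + 2) + fq (3 * s + 3) * z ^ (3 * s + 3))
      = (\<Sum>s<m. fq (3 * s + 1) * z + fq (3 * s + 2) * z ^ 2 + fq (3 * s + 3))] (mod int p ^ 2)"
  proof (intro cong_sum cong_add)
    fix s
    show "[fq (3 * s + 1) * z ^ (3 * s + 1) = fq (3 * s + 1) * z] (mod int p ^ 2)"
      using cong_scalar_left[OF z(1)[of s], of "fq (3 * s + 1) * z"] by (simp add: mult_ac)
    show "[fq (3 * s + 2) * z ^ (3 * s + 2) = fq (3 * s + 2) * z ^ 2] (mod int p ^ 2)"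
      using cong_scalar_left[OF z(1)[of s], of "fq (3 * s + 2) * z ^ 2"] by (simp add: mult_ac power_add power2_eq_square)
    show "[fq (3 * s + 3) * z ^ (3 * s + 3) = fq (3 * s + 3)] (mod int p ^ 2)"
      using cong_scalar_left[OF z(1)[of "Suc s"], of "fq (3 * s + 3)"] by (simp add: add.commute)
  qed
  have F3: "(\<Sum>s<m. fq (3 * s + 1) * z + fq (3 * s + 2) * z ^ 2 + fq (3 * s + 3)) = A0 * (1 - z)"
    unfolding sum.distrib sum_distrib_right[symmetric] A0_def[symmetric] A1_def[symmetric] A2_def[symmetric]
    unfolding A1 A2 by (simp add: algebra_simps)
  have F: "[Fq z = A0 * (1 - z)] (mod int p ^ 2)"
    using F2 unfolding F1[symmetric] F3 .
  have "[(1 - z) ^ p = 1 - z + int p * (A0 * (1 - z))] (mod int p ^ 2)"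
    using power_p_one_minus[OF z(2)] F by (meson cong_add cong_refl cong_scalar_left cong_trans)
  then have "[((1 - z) ^ p) ^ 2 = ((1 - z) * (1 + int p * A0)) ^ 2] (mod int p ^ 2)"
    by (intro cong_pow) (simp add: algebra_simps)
  also have "((1 - z) * (1 + int p * A0)) ^ 2 = (1 - z) ^ 2 * (1 + 2 * int p * A0) + int p ^ 2 * ((1 - z) * A0) ^ 2"
    by (simp add: power2_eq_square algebra_simps)
  also have "[\<dots> = (1 - z) ^ 2 * (1 + 2 * int p * A0)] (mod int p ^ 2)"
    by (simp add: cong_iff_dvd_diff)
  finally have 1: "[((1 - z) ^ p) ^ 2 = (1 - z) ^ 2 * (1 + 2 * int p * A0)] (mod int p ^ 2)" .
  have "(1 - z) ^ 2 - (- 3 * z) = z ^ 2 + z + 1"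
    by (simp add: power2_eq_square algebra_simps)
  then have 2: "[(1 - z) ^ 2 = - 3 * z] (mod int p ^ 2)"
    using assms by (metis cong_iff_dvd_diff diff_zero)
  have "[(- 3 * z) * (1 + 2 * int p * A0) = (1 - z) ^ 2 * (1 + 2 * int p * A0)] (mod int p ^ 2)"
    using 2 by (intro cong_mult) (auto simp: cong_sym)
  also have "[(1 - z) ^ 2 * (1 + 2 * int p * A0) = ((1 - z) ^ p) ^ 2] (mod int p ^ 2)" using 1 by (rule cong_sym)
  also have "((1 - z) ^ p) ^ 2 = ((1 - z) ^ 2) ^ p" by (simp add: power_mult[symmetric] mult.commute)
  also have "[\<dots> = (- 3 * z) ^ p] (mod int p ^ 2)" using 2 by (rule cong_pow)
  also have "(- 3 * z) ^ p = - (3 ^ p) * z ^ p" using odd_p by (simp add: power_mult_distrib)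
  also have "[\<dots> = - (3 ^ p) * z] (mod int p ^ 2)" using z(2) by (rule cong_scalar_left)
  also have "- (3 ^ p) * z = (- 3 * z) * 3 ^ (p - 1)"
    using p_eq by simp
  finally have "[(- 3 * z) * (1 + 2 * int p * A0) = (- 3 * z) * 3 ^ (p - 1)] (mod int p ^ 2)" .
  moreover have "\<not> int p dvd - 3 * z"
    using z(3) not_p_dvd_small[of 3] prime_int_p
    by (metis int_dvd_int_iff le_refl of_nat_numeral prime_dvd_mult_iff dvd_minus_iff zero_less_numeral)
  ultimately show ?thesis
    unfolding A0_def using coprime_p_imp_cancel cong_sym by blast
qed

text \<open>Modulo \<open>p\<close> the summand \<open>fq (3 * s + 3)\<close> is
  \<open>- 1 / (3 * (s + 1))\<close>, so the sum in \<open>power_3_cong_int\<close> becomes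
  \<open>- H / 3\<close>.\<close>

lemma power_3_pcong:
  assumes "[z ^ 2 + z + 1 = 0] (mod int p ^ 2)"
  shows "27 ^ m \<approx>[2] 1 - 2 / 3 * (of_nat p * H)"
proof -
  have "of_int (\<Sum>s<m. fq (3 * s + 3)) \<approx>[1] (\<Sum>s<m. - (1 / of_nat (3 * s + 3)))"
    unfolding of_int_sum using p_eq by (intro pcong_sum fq_pcong) auto
  also have "(\<Sum>s<m. - (1 / of_nat (3 * s + 3))) = (\<Sum>s<m. - (1 / 3 * (1 / of_nat (Suc s)) :: rat))"
    by (intro sum.cong) (simp_all add: field_simps)
  also have "\<dots> = - (1 / 3 * (\<Sum>s<m. 1 / of_nat (Suc s)))"
    by (simp only: sum_negf sum_distrib_left)
  also have "(\<Sum>s<m. 1 / of_nat (Suc s)) = H"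
    unfolding H_def by (simp add: sum.atLeast1_atMost_eq)
  finally have "of_nat p * of_int (\<Sum>s<m. fq (3 * s + 3)) \<approx>[2] of_nat p * - (1 / 3 * H)"
    by (rule pcong_p_mult)
  from pcong_add[OF pcong_refl[OF Zp_1] pcong_mult[OF pcong_refl[OF Zp_numeral] this]]
  have 1: "1 + 2 * (of_nat p * of_int (\<Sum>s<m. fq (3 * s + 3))) \<approx>[2] 1 + 2 * (of_nat p * - (1 / 3 * H))" .
  have "of_int (3 ^ (p - 1)) \<approx>[2] of_int (1 + 2 * int p * (\<Sum>s<m. fq (3 * s + 3)))"
    unfolding pcong_of_int_iff by (rule power_3_cong_int[OF assms])
  moreover have "(of_int (3 ^ (p - 1)) :: rat) = 27 ^ m" using p_eq by (simp add: power_mult)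
  moreover have "(of_int (1 + 2 * int p * (\<Sum>s<m. fq (3 * s + 3))) :: rat)
      = 1 + 2 * (of_nat p * of_int (\<Sum>s<m. fq (3 * s + 3)))"
    by (simp only: of_int_add of_int_mult of_int_1 of_int_numeral of_int_of_nat_eq mult.assoc)
  ultimately have "27 ^ m \<approx>[2] 1 + 2 * (of_nat p * of_int (\<Sum>s<m. fq (3 * s + 3)))"
    by (simp only:)
  from pcong_trans[OF this 1] show ?thesis by simp
qed

text \<open>For \<open>k = m\<close> the factor \<open>p / (3 * k + 1)\<close> is 1, so
  \<open>hyp_term m\<close> is split off and needed modulo \<open>p^2\<close>. The other terms give
  \<open>P / Q - C2\<close>, where \<open>P / Q = hyp_term m * X ^ 2 / Q ^ 2\<close>. All is
  expanded to first order in \<open>h = p * H\<close>, and the linear terms cancel.\<close>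

lemma sum_cong_1_mod_3:
  assumes "[z ^ 2 + z + 1 = 0] (mod int p ^ 2)"
  shows "(\<Sum>k = 0..m. hyp_term k * (of_nat p / of_nat (3 * k + 1))) \<approx>[2] of_nat ((2 * m) choose m)"
proof -
  define P Q X h C2 C3 where "P = (\<Prod>i<m. of_nat (3 * i + 2) :: rat)" and "Q = (\<Prod>i<m. of_nat (3 * i + 1) :: rat)"
    and "X = (3 ^ m * fact m :: rat)" and "h = of_nat p * H"
    and "C2 = (of_nat ((2 * m) choose m) :: rat)" and "C3 = (of_nat ((3 * m) choose m) :: rat)"
  have f: "fact (3 * m) = X * Q * P"
    unfolding fact_triple[of m] Q_def P_def X_def by (simp only: mult_ac)
  then have nz: "P \<noteq> 0" "Q \<noteq> 0" "X \<noteq> 0" by (metis fact_nonzero mult_eq_0_iff)+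
  have Zp: "P \<in> Zp" "X \<in> Zp" "Q \<in> Zp" "h \<in> Zp" "C2 \<in> Zp" "C3 \<in> Zp"
    using Zp_nat[of "3 ^ m * fact m"] unfolding P_def X_def Q_def h_def C2_def C3_def by auto
  have iQ: "1 / Q \<in> Zp"
  proof -
    have "1 / fact (3 * m) \<in> Zp" using p_eq by (intro Zp_inverse_fact) simp
    from Zp_mult[OF this Zp_mult[OF Zp(2) Zp(1)]] show ?thesis using nz unfolding f by simp
  qed
  \<comment> \<open>Here \<open>3 * i + 1 = p - 3 * (m - i)\<close>, and
    \<open>(- 3) ^ m = 3 ^ m\<close> because \<open>m\<close> is even.\<close>
  have E1: "Q \<approx>[2] X * (1 - 1 / 3 * h)"
  proof -
    have "Q = (\<Prod>i<m. of_nat p - 3 * of_nat (Suc (m - Suc i)))"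
      unfolding Q_def by (intro prod.cong) (auto simp: p_eq of_nat_diff)
    also have "\<dots> = (\<Prod>i<m. of_nat p - 3 * of_nat (Suc i))"
      by (rule prod.nat_diff_reindex)
    also have "\<dots> = (\<Prod>i<m. (- 3) * of_nat (Suc i) * (1 - of_nat p * (1 / 3 * (1 / of_nat (Suc i)))))"
      using of_nat_neq_0 by (intro prod.cong) (simp_all add: field_simps del: of_nat_Suc)
    also have "\<dots> = (- 3) ^ m * fact m * (\<Prod>i<m. 1 - of_nat p * (1 / 3 * (1 / of_nat (Suc i))))"
      by (simp only: prod.distrib prod_constant card_lessThan fact_prod_Suc of_nat_prod atLeast0LessThan)
    also have "(- 3) ^ m * fact m = X" using even_m by (simp add: X_def)
    also have "X * (\<Prod>i<m. 1 - of_nat p * (1 / 3 * (1 / of_nat (Suc i)))) \<approx>[2] X * (1 - of_nat p * (\<Sum>i<m. 1 / 3 * (1 / of_nat (Suc i))))"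
      using p_eq Zp by (intro pcong_mult pcong_refl pcong_prod_one_minus Zp_mult Zp_third Zp_inverse_less) auto
    also have "of_nat p * (\<Sum>i<m. 1 / 3 * (1 / of_nat (Suc i))) = 1 / 3 * h"
      unfolding h_def H_def sum_distrib_left[symmetric] by (simp add: sum.atLeast1_atMost_eq)
    finally show ?thesis .
  qed
  have E2: "27 ^ m \<approx>[2] 1 - 2 / 3 * h"
    unfolding h_def by (rule power_3_pcong[OF assms])
  have E3: "C3 \<approx>[2] 1 - h"
    using binomial_p_minus_1[of m] even_m p_eq by (simp add: C3_def h_def H_def)
  have h2: "of_nat p ^ 2 * H ^ 2 = h ^ 2" by (simp add: h_def power_mult_distrib)
  have i27: "1 / 27 ^ m \<approx>[2] 1 + 2 / 3 * h"
  proof -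
    have c: "2 / 3 * h \<in> Zp" using Zp_mult[OF Zp_mult[OF Zp_numeral Zp_third] Zp(4)] by simp
    have "27 ^ m * (1 + 2 / 3 * h) \<approx>[2] (1 - 2 / 3 * h) * (1 + 2 / 3 * h)"
      using c by (intro pcong_mult E2 pcong_refl) auto
    also have "\<dots> \<approx>[2] 1"
    proof (rule pcongI)
      show "- (4 * (1 / 3) ^ 2 * H ^ 2) \<in> Zp"
        by (intro Zp_mult Zp_power Zp_third Zp_H Zp_uminus Zp_numeral)
      show "(1 - 2 / 3 * h) * (1 + 2 / 3 * h) - 1 = of_nat p ^ 2 * - (4 * (1 / 3) ^ 2 * H ^ 2)"
        by (simp add: h_def power2_eq_square algebra_simps)
    qed (intro Zp_1 Zp_mult[OF Zp_diff[OF Zp_1 c] Zp_add[OF Zp_1 c]])+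
    finally have "27 ^ m * (1 + 2 / 3 * h) / 27 ^ m \<approx>[2] 1 / 27 ^ m"
      by (intro pcong_div Zp_inverse_27)
    then show ?thesis by (simp add: pcong_sym)
  qed
  have c: "2 / 3 * h \<in> Zp" "1 / 3 * h \<in> Zp"
    using Zp_mult[OF Zp_mult[OF Zp_numeral[of "num.Bit0 num.One"] Zp_third] Zp(4)] Zp_mult[OF Zp_third Zp(4)] by simp_all
  have "C2 * C3 / 27 ^ m = hyp_term m"
    unfolding hyp_term_def C2_def C3_def by simp
  moreover have "C2 * (C3 * (1 / 27 ^ m)) \<approx>[2] C2 * ((1 - h) * (1 + 2 / 3 * h))"
    using Zp by (intro pcong_mult pcong_refl E3 i27)
  ultimately have hyp: "hyp_term m \<approx>[2] C2 * ((1 - h) * (1 + 2 / 3 * h))" by simp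
  have "X ^ 2 / Q ^ 2 \<approx>[2] 1 + 2 / 3 * h"
  proof -
    have "Q ^ 2 * (1 + 2 / 3 * h) \<approx>[2] (X * (1 - 1 / 3 * h)) ^ 2 * (1 + 2 / 3 * h)"
      using c by (intro pcong_mult E1 pcong_refl pcong_power) auto
    also have "\<dots> \<approx>[2] X ^ 2"
    proof (rule pcongI)
      \<comment> \<open>The witnesses write their coefficients through powers of
        \<open>1 / 3\<close>, so that p-integrality follows from \<open>Zp_third\<close>.\<close>
      show "X ^ 2 * (H ^ 2 * (- 3 * (1 / 3) ^ 2 + 2 * (1 / 3) ^ 3 * h)) \<in> Zp"
        using Zp by (intro Zp_mult Zp_power Zp_add Zp_third Zp_H Zp_uminus Zp_numeral)
      have "(1 - 1 / 3 * h) ^ 2 * (1 + 2 / 3 * h) = 1 + h ^ 2 * (- 3 * (1 / 3) ^ 2 + 2 * (1 / 3) ^ 3 * h)"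
        by (simp add: power2_eq_square power3_eq_cube algebra_simps)
      moreover have "(X * a) ^ 2 * b - X ^ 2 = q * (X ^ 2 * (g * e))" if "a ^ 2 * b = 1 + q * g * e" for a b q g e
      proof -
        have "(X * a) ^ 2 * b = X ^ 2 * (a ^ 2 * b)" by (simp add: power_mult_distrib)
        then show ?thesis unfolding that by (simp add: algebra_simps)
      qed
      ultimately show "(X * (1 - 1 / 3 * h)) ^ 2 * (1 + 2 / 3 * h) - X ^ 2
        = of_nat p ^ 2 * (X ^ 2 * (H ^ 2 * (- 3 * (1 / 3) ^ 2 + 2 * (1 / 3) ^ 3 * h)))"
        unfolding h2[symmetric] by blast
    qed (use Zp c in \<open>auto intro!: Zp_mult Zp_power Zp_add Zp_diff\<close>)
    finally have "Q ^ 2 * (1 + 2 / 3 * h) / Q ^ 2 \<approx>[2] X ^ 2 / Q ^ 2"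
      by (intro pcong_div Zp_inverse_power iQ)
    then show ?thesis using nz by (simp add: pcong_sym)
  qed
  then have "hyp_term m * (X ^ 2 / Q ^ 2) \<approx>[2] hyp_term m * (1 + 2 / 3 * h)"
    by (intro pcong_mult pcong_refl hyp_term_Zp)
  also have "hyp_term m * (X ^ 2 / Q ^ 2) = P / Q"
    unfolding hyp_term_fact f using nz by (simp add: X_def[symmetric] power2_eq_square power3_eq_cube)
  finally have PQ: "P / Q \<approx>[2] hyp_term m * (1 + 2 / 3 * h)" .
  have "(\<Sum>k<m. hyp_term k * (of_nat p / of_nat (3 * k + 1)))
     \<approx>[2] of_nat p * (\<Sum>k<m. leg_coeff m k / of_nat (3 * k + 1))"
    using p_eq by (intro sum_cong_leg) auto
  \<comment> \<open>The denominator of the closed form also contains the factor for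
    \<open>i = m\<close>, which is \<open>p\<close>; the removed term \<open>k = m\<close> is
    \<open>C2 / p\<close>, as \<open>m\<close> is even.\<close>
  also have "(\<Sum>k<m. leg_coeff m k / of_nat (3 * k + 1)) = P / (Q * of_nat p) - C2 / of_nat p"
    using leg_coeff_sum_third[of m] even_m
    by (simp add: lessThan_Suc_atMost[symmetric] P_def Q_def C2_def p_eq leg_coeff_def mult_2)
  also have "of_nat p * (P / (Q * of_nat p) - C2 / of_nat p) = P / Q - C2"
    using p_gt3 nz by (simp add: field_simps)
  finally have "(\<Sum>k<m. hyp_term k * (of_nat p / of_nat (3 * k + 1))) + hyp_term m \<approx>[2] P / Q - C2 + hyp_term m"
    by (intro pcong_add pcong_refl hyp_term_Zp)
  also have "\<dots> \<approx>[2] hyp_term m * (1 + 2 / 3 * h) - C2 + hyp_term m"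
    using Zp by (intro pcong_add pcong_diff PQ pcong_refl hyp_term_Zp)
  also have "\<dots> = hyp_term m * (2 + 2 / 3 * h) - C2" by (simp add: algebra_simps)
  also have "\<dots> \<approx>[2] C2 * ((1 - h) * (1 + 2 / 3 * h)) * (2 + 2 / 3 * h) - C2"
    using Zp c by (intro pcong_diff pcong_mult[OF hyp] pcong_refl) auto
  also have "\<dots> \<approx>[2] C2"
  proof (rule pcongI)
    show "C2 * (H ^ 2 * (- 14 * (1 / 3) ^ 2 + - 4 * (1 / 3) ^ 2 * h)) \<in> Zp"
      using Zp by (intro Zp_mult Zp_power Zp_add Zp_third Zp_H Zp_uminus Zp_numeral)
    have "(1 - h) * (1 + 2 / 3 * h) * (2 + 2 / 3 * h) = 2 + h ^ 2 * (- 14 * (1 / 3) ^ 2 + - 4 * (1 / 3) ^ 2 * h)"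
      by (simp add: power2_eq_square power3_eq_cube algebra_simps add_divide_distrib diff_divide_distrib)
    moreover have "C2 * a * b - C2 - C2 = q * (C2 * (g * e))" if "a * b = 2 + q * g * e" for a b q g e
    proof -
      have "C2 * a * b = C2 * (a * b)" by simp
      then show ?thesis unfolding that by (simp add: algebra_simps)
    qed
    ultimately show "C2 * ((1 - h) * (1 + 2 / 3 * h)) * (2 + 2 / 3 * h) - C2 - C2
        = of_nat p ^ 2 * (C2 * (H ^ 2 * (- 14 * (1 / 3) ^ 2 + - 4 * (1 / 3) ^ 2 * h)))"
      unfolding h2[symmetric] by blast
  qed (use Zp c in \<open>auto intro!: Zp_mult Zp_power Zp_add Zp_diff\<close>)
  also have "(\<Sum>k<m. hyp_term k * (of_nat p / of_nat (3 * k + 1))) + hyp_term m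
     = (\<Sum>k = 0..m. hyp_term k * (of_nat p / of_nat (3 * k + 1)))"
    using p_gt3 unfolding atLeast0AtMost lessThan_Suc_atMost[symmetric] by (simp add: p_eq)
  finally show ?thesis by (simp add: C2_def)
qed

end

section \<open>Central binomial sums\<close>

text \<open>For \<open>s \<le> m\<close> this is \<open>(2 * m) choose (m - s)\<close> divided by
  the central binomial; so normalised it has simple recurrences in \<open>s\<close> and in
  \<open>m\<close>.\<close>

definition central_ratio :: "nat \<Rightarrow> nat \<Rightarrow> rat" where
  "central_ratio m s = fact m ^ 2 / (fact (m - s) * fact (m + s))"

lemma central_ratio_binomial:
  assumes "s \<le> m"
  shows "of_nat ((2 * m) choose (m - s)) = of_nat ((2 * m) choose m) * central_ratio m s"
proof -
  have "2 * m - (m - s) = m + s" "2 * m - m = m" using assms by auto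
  then show ?thesis
    using assms by (simp add: central_ratio_def binomial_fact power2_eq_square)
qed

lemma central_ratio_Suc:
  assumes "s < m"
  shows "of_nat (m + Suc s) * central_ratio m (Suc s) = (of_nat m - of_nat s) * central_ratio m s"
proof -
  have "m - s = Suc (m - Suc s)" using assms by simp
  then have "(fact (m - s) :: rat) = of_nat (m - s) * fact (m - Suc s)" by (metis fact_Suc)
  then have f: "(fact (m - s) :: rat) = (of_nat m - of_nat s) * fact (m - Suc s)"
    using assms by (simp add: of_nat_diff)
  have g: "(fact (m + Suc s) :: rat) = of_nat (m + Suc s) * fact (m + s)" by (simp add: fact_Suc)
  have "of_nat (m + Suc s) * (F / (A * (of_nat (m + Suc s) * B))) = d * (F / (d * A * B))"
    if "d \<noteq> 0" for F A B d :: rat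
  proof -
    have "of_nat (m + Suc s) * (F / (A * (of_nat (m + Suc s) * B))) = F / (A * B)"
      by (simp del: of_nat_Suc of_nat_add)
    then show ?thesis using that by simp
  qed
  then show ?thesis
    unfolding central_ratio_def f g using assms by auto
qed

lemma central_ratio_step:
  assumes "s \<le> m"
  shows "of_nat (Suc m) ^ 2 * central_ratio m s = (of_nat (Suc m) ^ 2 - of_nat s ^ 2) * central_ratio (Suc m) s"
proof -
  have 1: "(fact (Suc m - s) :: rat) = (of_nat (Suc m) - of_nat s) * fact (m - s)"
    using assms by (simp add: Suc_diff_le of_nat_diff)
  have 2: "(fact (Suc m + s) :: rat) = (of_nat (Suc m) + of_nat s) * fact (m + s)"
    by (simp add: fact_Suc)
  have 3: "(fact (Suc m) :: rat) = of_nat (Suc m) * fact m" by (simp add: fact_Suc)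
  have "a ^ 2 * (F ^ 2 / (A * B)) = (a ^ 2 - b ^ 2) * ((a * F) ^ 2 / ((a - b) * A * ((a + b) * B)))"
    if "a - b \<noteq> 0" "a + b \<noteq> 0" "A \<noteq> 0" "B \<noteq> 0" for a b F A B :: rat
  proof -
    have "a ^ 2 - b ^ 2 = (a - b) * (a + b)" by (simp add: power2_eq_square algebra_simps)
    then show ?thesis using that by (simp add: power_mult_distrib)
  qed
  moreover have "(of_nat (Suc m) - of_nat s :: rat) \<noteq> 0" using assms by (simp del: of_nat_Suc)
  moreover have "(of_nat (Suc m) + of_nat s :: rat) \<noteq> 0" by (metis of_nat_add of_nat_eq_0_iff add_is_0 nat.distinct(1))
  ultimately show ?thesis unfolding central_ratio_def 1 2 3 by simp
qed

lemma central_ratio_0 [simp]: "central_ratio m 0 = 1"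
  by (simp add: central_ratio_def power2_eq_square)

text \<open>The sum telescopes by \<open>central_ratio_Suc\<close>: up to a constant, the partial
  sum to \<open>n\<close> is a multiple of \<open>(m - n) * central_ratio m n\<close>, which
  vanishes at \<open>n = m\<close>.\<close>

lemma sum_central_ratio:
  assumes "0 < m" shows "(\<Sum>s=1..m. (- 1) ^ s * central_ratio m s) = - 1 / 2"
proof -
  have "2 * of_nat m * (\<Sum>s=1..n. (- 1) ^ s * central_ratio m s)
      = (- 1) ^ n * (of_nat m - of_nat n) * central_ratio m n - of_nat m" if "n \<le> m" for n
    using that
  proof (induction n)
    case (Suc n)
    have "2 * of_nat m * (\<Sum>s=1..Suc n. (- 1) ^ s * central_ratio m s)
        = (- 1) ^ n * ((of_nat m - of_nat n) * central_ratio m n) - of_nat m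
          - 2 * of_nat m * (- 1) ^ n * central_ratio m (Suc n)"
      using Suc by (simp add: algebra_simps)
    also have "(of_nat m - of_nat n) * central_ratio m n = of_nat (m + Suc n) * central_ratio m (Suc n)"
      using Suc.prems central_ratio_Suc[of n m] by simp
    finally show ?case by (simp add: algebra_simps)
  qed simp
  from this[of m] have "of_nat m * (2 * (\<Sum>s=1..m. (- 1) ^ s * central_ratio m s)) = of_nat m * - 1" by simp
  then have "2 * (\<Sum>s=1..m. (- 1) ^ s * central_ratio m s) = - 1"
    by (subst (asm) mult_left_cancel) (use assms in simp_all)
  then show ?thesis by simp
qed

text \<open>The same telescoping, now with the extra weight \<open>2 * n + 1\<close>.\<close>

lemma sum_weighted_central_ratio:
  "2 * (2 * of_nat m - 1) * (\<Sum>s=1..m. (- 1) ^ s * of_nat s * central_ratio m s) = - of_nat m"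
proof -
  have "2 * (2 * of_nat m - 1) * (\<Sum>s=1..n. (- 1) ^ s * of_nat s * central_ratio m s)
      = (- 1) ^ n * (2 * of_nat n + 1) * ((of_nat m - of_nat n) * central_ratio m n) - of_nat m" if "n \<le> m" for n
    using that
  proof (induction n)
    case (Suc n)
    have "2 * (2 * of_nat m - 1) * (\<Sum>s=1..Suc n. (- 1) ^ s * of_nat s * central_ratio m s)
        = (- 1) ^ n * (2 * of_nat n + 1) * ((of_nat m - of_nat n) * central_ratio m n) - of_nat m
          - 2 * (2 * of_nat m - 1) * (- 1) ^ n * of_nat (Suc n) * central_ratio m (Suc n)"
      using Suc by (simp add: algebra_simps)
    also have "(of_nat m - of_nat n) * central_ratio m n = of_nat (m + Suc n) * central_ratio m (Suc n)"
      using Suc.prems central_ratio_Suc[of n m] by simp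
    finally show ?case by (simp add: algebra_simps)
  qed simp
  from this[of m] show ?thesis by simp
qed

text \<open>By \<open>central_ratio_step\<close> the ratio for \<open>m\<close> is
  \<open>1 - s ^ 2 / M ^ 2\<close> times the ratio for \<open>M = m + 1\<close>, so consecutive sums
  differ by the weighted sum divided by \<open>M ^ 2\<close>.\<close>

lemma sum_central_ratio_harmonic:
  "(\<Sum>s=1..m. (- 1) ^ s * central_ratio m s / of_nat s) = (\<Sum>i=1..m. 1 / of_nat i) - (\<Sum>i=1..2 * m. 1 / of_nat i)"
proof (induction m)
  case (Suc m)
  define M :: rat where "M = of_nat (Suc m)"
  have M: "M \<noteq> 0" "2 * M - 1 \<noteq> 0"
  proof -
    have "2 * M - 1 = of_nat (2 * m + 1)" by (simp add: M_def)
    then show "2 * M - 1 \<noteq> 0" by (simp only: of_nat_eq_0_iff)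
  qed (simp add: M_def del: of_nat_Suc)
  let ?R = "central_ratio (Suc m)"
  have "(\<Sum>s=1..m. (- 1) ^ s * central_ratio m s / of_nat s)
      = (\<Sum>s=1..m. (- 1) ^ s * ?R s / of_nat s - (- 1) ^ s * of_nat s * ?R s / M ^ 2)"
  proof (intro sum.cong refl)
    fix s assume s: "s \<in> {1..m}"
    then have "M ^ 2 * central_ratio m s = (M ^ 2 - of_nat s ^ 2) * ?R s"
      unfolding M_def by (intro central_ratio_step) auto
    then have "central_ratio m s = (M ^ 2 - of_nat s ^ 2) * ?R s / M ^ 2"
      using M by (simp add: field_simps)
    then show "(- 1) ^ s * central_ratio m s / of_nat s
        = (- 1) ^ s * ?R s / of_nat s - (- 1) ^ s * of_nat s * ?R s / M ^ 2"
    proof -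
      have "e * ((M ^ 2 - b ^ 2) * r / M ^ 2) / b = e * r / b - e * b * r / M ^ 2" if "b \<noteq> 0" for e b r
        using M that by (simp add: field_simps power2_eq_square)
      then show ?thesis using s \<open>central_ratio m s = _\<close> by simp
    qed
  qed
  \<comment> \<open>The appended term \<open>s = M\<close> is zero: its two parts cancel.\<close>
  also have "\<dots> = (\<Sum>s=1..Suc m. (- 1) ^ s * ?R s / of_nat s - (- 1) ^ s * of_nat s * ?R s / M ^ 2)"
    using M by (simp add: M_def power2_eq_square del: of_nat_Suc)
  also have "\<dots> = (\<Sum>s=1..Suc m. (- 1) ^ s * ?R s / of_nat s) - (\<Sum>s=1..Suc m. (- 1) ^ s * of_nat s * ?R s) / M ^ 2"
    by (simp only: sum_subtractf sum_divide_distrib)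
  also have "(\<Sum>s=1..Suc m. (- 1) ^ s * of_nat s * ?R s) = - M / (2 * (2 * M - 1))"
    using sum_weighted_central_ratio[of "Suc m"] M unfolding M_def[symmetric]
    by (intro eq_divide_imp) (simp_all only: mult.commute mult_eq_0_iff zero_neq_numeral not_False_eq_True simp_thms)
  finally have "(\<Sum>s=1..Suc m. (- 1) ^ s * ?R s / of_nat s)
      = (\<Sum>i=1..m. 1 / of_nat i) - (\<Sum>i=1..2 * m. 1 / of_nat i) + (- M / (2 * (2 * M - 1))) / M ^ 2"
    using Suc by simp
  also have "(- M / (2 * (2 * M - 1))) / M ^ 2 = 1 / M - 1 / (2 * M - 1) - 1 / (2 * M)"
    using M by (simp add: field_simps power2_eq_square)
  also have "(\<Sum>i=1..m. 1 / of_nat i) - (\<Sum>i=1..2 * m. 1 / of_nat i) + (1 / M - 1 / (2 * M - 1) - 1 / (2 * M))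
      = (\<Sum>i=1..Suc m. 1 / of_nat i) - (\<Sum>i=1..2 * Suc m. 1 / of_nat i)"
    by (simp add: M_def)
  finally show ?case .
qed simp

section \<open>Lifting congruences to p^2, and sums over residue classes\<close>

lemma sum_lessThan_add:
  fixes m n :: nat
  shows "(\<Sum>k<m + n. f k) = (\<Sum>k<m. f k) + (\<Sum>k<n. f (m + k) :: 'a :: comm_monoid_add)"
  by (induction n) (simp_all add: add.assoc)

lemma cong_power_add_multiple:
  fixes a b q :: int
  shows "[(a + q * b) ^ Suc n = a ^ Suc n + q * (int (Suc n) * b * a ^ n)] (mod q ^ 2)"
proof (induction n)
  case (Suc n)
  have "[(a + q * b) * (a + q * b) ^ Suc n = (a + q * b) * (a ^ Suc n + q * (int (Suc n) * b * a ^ n))] (mod q ^ 2)"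
    by (rule cong_scalar_left[OF Suc])
  moreover have "(a + q * b) * (a ^ Suc n + q * (int (Suc n) * b * a ^ n))
      = a ^ Suc (Suc n) + q * (int (Suc (Suc n)) * b * a ^ Suc n) + q ^ 2 * (b * int (Suc n) * b * a ^ n)"
    by (simp add: power2_eq_square algebra_simps)
  ultimately have "[(a + q * b) ^ Suc (Suc n)
      = a ^ Suc (Suc n) + q * (int (Suc (Suc n)) * b * a ^ Suc n) + q ^ 2 * (b * int (Suc n) * b * a ^ n)] (mod q ^ 2)"
    by simp
  then show ?case
    by (smt (verit, ccfv_threshold) cong_iff_dvd_diff dvd_add_right_iff dvd_triv_left cong_trans add_diff_cancel_left')
qed simp

context prime_local
begin

text \<open>In the factorisation of \<open>a ^ p - b ^ p\<close> by \<open>a - b\<close> the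
  cofactor has \<open>p\<close> terms, all congruent to \<open>b ^ (p - 1)\<close>, so both factors
  are divisible by \<open>p\<close>.\<close>

lemma cong_power_p_lift:
  assumes "[a = b] (mod int p)" shows "[a ^ p = b ^ p] (mod int p ^ 2)"
proof -
  have "[(\<Sum>i<p. b ^ (p - Suc i) * a ^ i) = (\<Sum>i<p. b ^ (p - Suc i) * b ^ i)] (mod int p)"
    using assms by (intro cong_sum cong_scalar_left cong_pow)
  also have "(\<Sum>i<p. b ^ (p - Suc i) * b ^ i) = (\<Sum>i<p. b ^ (p - 1))"
    by (intro sum.cong) (auto simp: power_add[symmetric])
  also have "\<dots> = int p * b ^ (p - 1)" by simp
  finally have "int p dvd (\<Sum>i<p. b ^ (p - Suc i) * a ^ i)"
    by (metis cong_dvd_iff dvd_triv_left)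
  moreover have "int p dvd a - b" using assms by (simp add: cong_iff_dvd_diff)
  ultimately have "int p * int p dvd (a - b) * (\<Sum>i<p. b ^ (p - Suc i) * a ^ i)"
    by (intro mult_dvd_mono)
  then show ?thesis
    by (simp add: cong_iff_dvd_diff power_diff_sumr2 power2_eq_square)
qed

lemma fermat_int: "[x ^ p = x] (mod int p)"
proof (cases "int p dvd x")
  case True
  moreover from this have "int p dvd x ^ p"
    using prime_gt_0_nat[OF prime_p] by (meson dvd_power dvd_trans)
  ultimately show ?thesis by (simp add: cong_iff_dvd_diff)
next
  case False
  define y where "y = nat (x mod int p)"
  have p0: "int p > 0" using prime_gt_0_nat[OF prime_p] by simp
  then have y: "int y = x mod int p" by (simp add: y_def)
  have "\<not> p dvd y" using False y by (metis dvd_mod_iff dvd_refl int_dvd_int_iff)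
  then have "[y ^ (p - 1) = 1] (mod p)" using prime_p by (rule fermat_theorem[rotated])
  then have "[int y ^ (p - 1) = 1] (mod int p)" by (metis cong_int_iff of_nat_1 of_nat_power)
  then have "[int y * int y ^ (p - 1) = int y * 1] (mod int p)" by (rule cong_scalar_left)
  then have "[int y ^ p = int y] (mod int p)"
    using prime_gt_0_nat[OF prime_p] by (simp add: power_eq_if)
  moreover have "[int y = x] (mod int p)" by (simp add: y)
  ultimately show ?thesis by (meson cong_pow cong_sym cong_trans)
qed

text \<open>An affine map with invertible slope permutes the residue classes, and a periodic
  \<open>f\<close> sees only the class.\<close>

lemma sum_residues_affine:
  fixes f :: "int \<Rightarrow> 'a :: comm_monoid_add"
  assumes "\<And>x. f (x mod int p) = f x" "\<not> int p dvd g"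
  shows "(\<Sum>x\<in>{0..<int p}. f (g * x + c)) = (\<Sum>x\<in>{0..<int p}. f x)"
proof -
  let ?h = "\<lambda>x. (g * x + c) mod int p"
  have sub: "?h ` {0..<int p} \<subseteq> {0..<int p}"
    using prime_gt_0_nat[OF prime_p] by auto
  have inj: "inj_on ?h {0..<int p}"
  proof (rule inj_onI)
    fix x y assume xy: "x \<in> {0..<int p}" "y \<in> {0..<int p}" "?h x = ?h y"
    then have "int p dvd g * (x - y)" by (simp add: mod_eq_dvd_iff right_diff_distrib)
    then have "int p dvd x - y" using assms(2) prime_dvd_mult_iff[OF prime_int_p] by blast
    then have "x mod int p = y mod int p" by (simp add: mod_eq_dvd_iff)
    then show "x = y" using xy(1,2) by auto
  qed
  have "bij_betw ?h {0..<int p} {0..<int p}"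
    using endo_inj_surj[OF _ sub inj] inj by (simp add: bij_betw_def)
  from sum.reindex_bij_betw[OF this, of f] show ?thesis by (simp add: assms(1))
qed

lemma sum_residues_0: "(\<Sum>x\<in>{0..<int p}. f x) = f 0 + (\<Sum>x\<in>{1..<int p}. f x :: 'a :: comm_monoid_add)"
proof -
  have "{0..<int p} = insert 0 {1..<int p}" using prime_gt_0_nat[OF prime_p] by auto
  then show ?thesis by simp
qed

lemma sum_residues_mult:
  fixes f :: "int \<Rightarrow> 'a :: ab_group_add"
  assumes "\<And>x. f (x mod int p) = f x" "\<not> int p dvd g"
  shows "(\<Sum>x\<in>{1..<int p}. f (g * x)) = (\<Sum>x\<in>{1..<int p}. f x)"
  using sum_residues_affine[of f g 0, OF assms] unfolding sum_residues_0 by simp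

lemma obtain_primroot:
  obtains g :: int where "\<not> int p dvd g" "\<And>k. [g ^ k = 1] (mod int p) \<longleftrightarrow> (p - 1) dvd k"
proof -
  obtain g where g: "residue_primroot p g"
    using prime_primitive_root_exists[of p] prime_p prime_gt_1_nat by blast
  then have "coprime p g" "ord p g = p - 1"
    using prime_p by (auto simp: residue_primroot_def totient_prime)
  show ?thesis
  proof (rule that[of "int g"])
    show "\<not> int p dvd int g"
      using \<open>coprime p g\<close> prime_p by (metis coprime_absorb_left int_dvd_int_iff not_prime_unit)
    fix k
    have "[int g ^ k = 1] (mod int p) \<longleftrightarrow> [g ^ k = 1] (mod p)"
      by (metis cong_int_iff of_nat_1 of_nat_power)
    then show "[int g ^ k = 1] (mod int p) \<longleftrightarrow> (p - 1) dvd k"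
      using ord_divides[of g k p] \<open>ord p g = p - 1\<close> by simp
  qed
qed

end

section \<open>Power sums of Teichmueller representatives\<close>

context prime_gt3
begin

text \<open>Modulo \<open>p^2\<close> this is the Teichmueller representative of the class of
  \<open>x\<close>: \<open>teich_power_p\<close> shows that it is fixed by the \<open>p\<close>-th
  power.\<close>

definition teich :: "int \<Rightarrow> int" where "teich x = x ^ p"

lemma teich_power_p: "[teich x ^ p = teich x] (mod int p ^ 2)"
  unfolding teich_def by (rule cong_power_p_lift[OF fermat_int])

lemma teich_cong: "[teich x = x] (mod int p)"
  unfolding teich_def by (rule fermat_int)

lemma power_p_minus_1_cong_1:
  assumes "\<not> int p dvd x" shows "[x ^ (p - 1) = 1] (mod int p)"
proof -
  have "[x * x ^ (p - 1) = x * 1] (mod int p)"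
    using fermat_int[of x] p_gt3 by (simp add: power_eq_if)
  moreover have "coprime x (int p)"
    using assms prime_imp_coprime[OF prime_int_p, of x] by (simp add: coprime_commute)
  ultimately show ?thesis by (simp only: cong_mult_lcancel)
qed

text \<open>If \<open>p - 1\<close> divides \<open>j\<close>, every summand is 1 by lifting Fermat.
  Otherwise scaling \<open>x\<close> by a primitive root \<open>g\<close> multiplies the sum by
  \<open>teich g ^ j\<close>, and \<open>teich g ^ j - 1\<close> is a unit.\<close>

lemma sum_teich_power:
  "[(\<Sum>x\<in>{1..<int p}. teich x ^ j) = (if (p - 1) dvd j then int p - 1 else 0)] (mod int p ^ 2)"
proof (cases "(p - 1) dvd j")
  case True
  then obtain i where i: "j = (p - 1) * i" by blast
  have "[(\<Sum>x\<in>{1..<int p}. teich x ^ j) = (\<Sum>x\<in>{1..<int p}. 1)] (mod int p ^ 2)"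
  proof (rule cong_sum)
    fix x assume "x \<in> {1..<int p}"
    then have "\<not> int p dvd x" by (auto dest: zdvd_imp_le)
    then have "[(x ^ (p - 1)) ^ p = 1 ^ p] (mod int p ^ 2)"
      by (intro cong_power_p_lift power_p_minus_1_cong_1)
    then have "[((x ^ (p - 1)) ^ p) ^ i = (1 ^ p) ^ i] (mod int p ^ 2)" by (rule cong_pow)
    then show "[teich x ^ j = 1] (mod int p ^ 2)"
      unfolding teich_def i by (simp add: power_mult[symmetric] mult_ac)
  qed
  moreover have "(\<Sum>x\<in>{1..<int p}. 1) = int p - 1" using p_gt3 by simp
  ultimately show ?thesis using True by simp
next
  case False
  obtain g :: int where g: "\<not> int p dvd g" "\<And>k. [g ^ k = 1] (mod int p) \<longleftrightarrow> (p - 1) dvd k"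
    by (rule obtain_primroot) blast
  \<comment> \<open>Reducing each summand modulo \<open>p^2\<close> makes it exactly periodic, as
    \<open>sum_residues_mult\<close> requires.\<close>
  let ?S = "\<Sum>x\<in>{1..<int p}. teich x ^ j mod int p ^ 2"
  have eq: "[?S = (\<Sum>x\<in>{1..<int p}. teich x ^ j)] (mod int p ^ 2)"
    by (intro cong_sum) simp
  have "?S = (\<Sum>x\<in>{1..<int p}. teich (g * x) ^ j mod int p ^ 2)"
  proof (rule sum_residues_mult[symmetric, where f = "\<lambda>x. teich x ^ j mod int p ^ 2"])
    fix x
    have "[teich (x mod int p) ^ j = teich x ^ j] (mod int p ^ 2)"
      unfolding teich_def by (intro cong_pow cong_power_p_lift) simp
    then show "teich (x mod int p) ^ j mod int p ^ 2 = teich x ^ j mod int p ^ 2"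
      by (simp add: cong_def)
  qed (rule g)
  moreover have "[(\<Sum>x\<in>{1..<int p}. teich (g * x) ^ j mod int p ^ 2) = (\<Sum>x\<in>{1..<int p}. teich g ^ j * teich x ^ j)] (mod int p ^ 2)"
    by (intro cong_sum) (simp add: teich_def power_mult_distrib)
  ultimately have "[?S = teich g ^ j * (\<Sum>x\<in>{1..<int p}. teich x ^ j)] (mod int p ^ 2)"
    by (simp add: sum_distrib_left)
  with eq have "[teich g ^ j * (\<Sum>x\<in>{1..<int p}. teich x ^ j) = (\<Sum>x\<in>{1..<int p}. teich x ^ j)] (mod int p ^ 2)"
    by (meson cong_sym cong_trans)
  then have "int p ^ 2 dvd (teich g ^ j - 1) * (\<Sum>x\<in>{1..<int p}. teich x ^ j)"
    by (simp add: cong_iff_dvd_diff left_diff_distrib)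
  moreover have "\<not> int p dvd teich g ^ j - 1"
  proof
    assume "int p dvd teich g ^ j - 1"
    then have "[teich g ^ j = 1] (mod int p)" by (simp add: cong_iff_dvd_diff)
    moreover have "[teich g ^ j = g ^ j] (mod int p)" by (intro cong_pow teich_cong)
    ultimately have "[g ^ j = 1] (mod int p)" by (meson cong_sym cong_trans)
    with g(2) False show False by blast
  qed
  then have "coprime (int p ^ 2) (teich g ^ j - 1)"
    using prime_imp_coprime[OF prime_int_p] by simp
  ultimately have "int p ^ 2 dvd (\<Sum>x\<in>{1..<int p}. teich x ^ j)"
    by (simp add: coprime_dvd_mult_right_iff)
  then show ?thesis using False by (simp add: cong_iff_dvd_diff)
qed

lemma cong_mod_p_of_mod_p2: "[a = b] (mod int p ^ 2) \<Longrightarrow> [a = b] (mod int p)"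
  by (auto simp: cong_iff_dvd_diff power2_eq_square intro: dvd_mult_left)

lemma sum_teich_power_mod_p:
  "[(\<Sum>x\<in>{1..<int p}. teich x ^ j) = (if (p - 1) dvd j then - 1 else 0)] (mod int p)"
proof -
  have "[(if (p - 1) dvd j then int p - 1 else 0) = (if (p - 1) dvd j then - 1 else 0)] (mod int p)"
    by (simp add: cong_iff_dvd_diff)
  with cong_mod_p_of_mod_p2[OF sum_teich_power[of j]] show ?thesis by (rule cong_trans)
qed

lemma cong_p_mult: "[a = b] (mod int p) \<Longrightarrow> [int p * a = int p * b] (mod int p ^ 2)"
  by (auto simp: cong_iff_dvd_diff power2_eq_square right_diff_distrib[symmetric] intro: mult_dvd_mono)

end

section \<open>The sum of the powers (x (1 - x))^(2 m p)\<close>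

lemma one_minus_power:
  fixes t :: "'a :: comm_ring_1"
  shows "(1 - t) ^ n = (\<Sum>k\<le>n. of_nat (n choose k) * (- 1) ^ k * t ^ k)"
proof -
  have "(1 - t) ^ n = (\<Sum>k\<le>n. of_nat (n choose k) * (- t) ^ k)"
    using binomial_ring[of "- t" 1 n] by simp
  also have "\<dots> = (\<Sum>k\<le>n. of_nat (n choose k) * (- 1) ^ k * t ^ k)"
    by (intro sum.cong refl) (metis power_minus mult.assoc)
  finally show ?thesis .
qed

context prime_1_mod_3
begin

text \<open>The exponents \<open>2 * m + k\<close> of the expansion run from \<open>2 * m\<close> to
  \<open>4 * m\<close>, where only \<open>3 * m\<close> is divisible by \<open>p - 1\<close>. This
  leaves \<open>k = m\<close>, with positive sign as \<open>m\<close> is even.\<close>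

lemma sum_teich_main_term:
  "[(\<Sum>x\<in>{1..<int p}. teich x ^ (2 * m) * (1 - teich x) ^ (2 * m)) = (int p - 1) * int ((2 * m) choose m)] (mod int p ^ 2)"
proof -
  have "(\<Sum>x\<in>{1..<int p}. teich x ^ (2 * m) * (1 - teich x) ^ (2 * m))
      = (\<Sum>x\<in>{1..<int p}. \<Sum>k\<le>2 * m. int ((2 * m) choose k) * (- 1) ^ k * teich x ^ (2 * m + k))"
    unfolding one_minus_power sum_distrib_left by (intro sum.cong refl) (simp add: power_add)
  also have "\<dots> = (\<Sum>k\<le>2 * m. int ((2 * m) choose k) * (- 1) ^ k * (\<Sum>x\<in>{1..<int p}. teich x ^ (2 * m + k)))"
    by (subst sum.swap) (simp add: sum_distrib_left)
  finally have 1: "(\<Sum>x\<in>{1..<int p}. teich x ^ (2 * m) * (1 - teich x) ^ (2 * m)) = \<dots>" .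
  have "[(\<Sum>k\<le>2 * m. int ((2 * m) choose k) * (- 1) ^ k * (\<Sum>x\<in>{1..<int p}. teich x ^ (2 * m + k)))
      = (\<Sum>k\<le>2 * m. int ((2 * m) choose k) * (- 1) ^ k * (if (p - 1) dvd (2 * m + k) then int p - 1 else 0))] (mod int p ^ 2)"
    by (intro cong_sum cong_scalar_left sum_teich_power)
  moreover have "(\<Sum>k\<le>2 * m. int ((2 * m) choose k) * (- 1) ^ k * (if (p - 1) dvd (2 * m + k) then int p - 1 else 0))
      = (\<Sum>k\<in>{m}. int ((2 * m) choose k) * (- 1) ^ k * (int p - 1))"
  proof (rule sum.mono_neutral_cong_right)
    have "k = m" if k: "k \<le> 2 * m" "(p - 1) dvd (2 * m + k)" for k
    proof -
      obtain c where c: "2 * m + k = 3 * m * c" using k(2) p_eq by auto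
      have "c \<noteq> 0" using c m_pos by (intro notI) simp
      moreover have "c < 2"
      proof (rule ccontr)
        assume "\<not> c < 2"
        then have "3 * m * 2 \<le> 3 * m * c" by (intro mult_le_mono2) simp
        then show False using c k(1) m_pos by linarith
      qed
      ultimately have "c = 1" by simp
      then show ?thesis using c by simp
    qed
    then show "\<forall>k\<in>{..2 * m} - {m}. int ((2 * m) choose k) * (- 1) ^ k * (if (p - 1) dvd (2 * m + k) then int p - 1 else 0) = 0"
      by auto
  qed (auto simp: p_eq)
  ultimately show ?thesis unfolding 1 using even_m by (simp add: mult.commute)
qed

text \<open>The two exponents lie strictly between 0 and \<open>6 * m\<close>, respectively
  \<open>3 * m\<close> and \<open>9 * m\<close>, so the only candidates are \<open>3 * m\<close> and
  \<open>6 * m\<close>.\<close>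

lemma dvd_exponent_iff:
  assumes "k < m" "i \<in> {1..<p}"
  shows "(p - 1) dvd (2 * m + k + i) \<longleftrightarrow> i = m - k"
    and "(p - 1) dvd (2 * m + (m + k) + i) \<longleftrightarrow> i = p - Suc k"
proof -
  have *: "(3 * m) dvd n \<longleftrightarrow> n = 3 * m * c" if "3 * m * (c - 1) < n" "n < 3 * m * (c + 1)" "c > 0" for n c
  proof
    assume "3 * m dvd n"
    then obtain d where d: "n = 3 * m * d" by blast
    have "c - 1 < d" "d < c + 1" using that(1,2) unfolding d by (simp_all only: mult_less_cancel1)
    then have "d = c" using that(3) by simp
    then show "n = 3 * m * c" using d by simp
  qed simp
  show "(p - 1) dvd (2 * m + k + i) \<longleftrightarrow> i = m - k"
    using *[of 1 "2 * m + k + i"] assms p_eq by auto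
  show "(p - 1) dvd (2 * m + (m + k) + i) \<longleftrightarrow> i = p - Suc k"
    using *[of 2 "2 * m + (m + k) + i"] assms p_eq by auto
qed

text \<open>Precision \<open>p\<close> is enough because this sum enters multiplied by
  \<open>p\<close>. For each \<open>k\<close> in the expansion the power sums select one
  \<open>i\<close>; the halves \<open>k < m\<close> and \<open>k \<ge> m\<close> give equal sums,
  whence the factor 2.\<close>

lemma sum_teich_correction:
  "[(\<Sum>x\<in>{1..<int p}. teich x ^ (2 * m) * (1 - teich x) ^ (2 * m - 1) * Fq (teich x))
     = 2 * (\<Sum>j<m. (- 1) ^ j * int ((2 * m - 1) choose (m - Suc j)) * fq (Suc j))] (mod int p)"
proof -
  define b where "b k = int ((2 * m - 1) choose k) * (- 1) ^ k" for k
  have m2: "{..2 * m - 1} = {..<m + m}" using m_pos by auto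
  have "(\<Sum>x\<in>{1..<int p}. teich x ^ (2 * m) * (1 - teich x) ^ (2 * m - 1) * Fq (teich x))
      = (\<Sum>x\<in>{1..<int p}. \<Sum>k<m + m. \<Sum>i\<in>{1..<p}. b k * fq i * teich x ^ (2 * m + k + i))"
    unfolding one_minus_power Fq_def m2 b_def[symmetric] of_nat_id[symmetric]
    by (intro sum.cong refl) (simp add: sum_distrib_left sum_distrib_right power_add b_def mult_ac)
  also have "\<dots> = (\<Sum>k<m + m. \<Sum>i\<in>{1..<p}. b k * fq i * (\<Sum>x\<in>{1..<int p}. teich x ^ (2 * m + k + i)))"
    by (subst sum.swap, intro sum.cong refl, subst sum.swap) (simp add: sum_distrib_left)
  finally have 1: "(\<Sum>x\<in>{1..<int p}. teich x ^ (2 * m) * (1 - teich x) ^ (2 * m - 1) * Fq (teich x)) = \<dots>" .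
  define G where "G k = (\<Sum>i\<in>{1..<p}. b k * fq i * (if (p - 1) dvd (2 * m + k + i) then - 1 else 0))" for k
  have 2: "[(\<Sum>k<m + m. \<Sum>i\<in>{1..<p}. b k * fq i * (\<Sum>x\<in>{1..<int p}. teich x ^ (2 * m + k + i)))
      = (\<Sum>k<m + m. G k)] (mod int p)"
    unfolding G_def by (intro cong_sum cong_scalar_left sum_teich_power_mod_p)
  have G1: "G k = - (b k * fq (m - k))" if "k < m" for k
  proof -
    have "G k = (\<Sum>i\<in>{1..<p}. if i = m - k then - (b k * fq i) else 0)"
      unfolding G_def using dvd_exponent_iff(1)[OF that] by (intro sum.cong) auto
    moreover have "m - k \<in> {1..<p}" using that p_eq by auto
    ultimately show ?thesis by (simp only: sum.delta finite_atLeastLessThan if_True)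
  qed
  have G2: "G (m + k) = b (m + k) * fq (Suc k)" if "k < m" for k
  proof -
    have "G (m + k) = (\<Sum>i\<in>{1..<p}. if i = p - Suc k then - (b (m + k) * fq i) else 0)"
      unfolding G_def using dvd_exponent_iff(2)[OF that] by (intro sum.cong) auto
    also have "\<dots> = - (b (m + k) * fq (p - Suc k))"
    proof -
      have "p - Suc k \<in> {1..<p}" using that p_eq by auto
      then show ?thesis by (simp only: sum.delta finite_atLeastLessThan if_True)
    qed
    finally show ?thesis using fq_reflect[of "Suc k"] that p_eq by simp
  qed
  have "(\<Sum>k<m. G k) = (\<Sum>k<m. - (b k * fq (m - k)))" using G1 by (intro sum.cong) auto
  also have "\<dots> = (\<Sum>j<m. - (b (m - Suc j) * fq (m - (m - Suc j))))"
    by (rule sum.nat_diff_reindex[symmetric])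
  also have "\<dots> = (\<Sum>j<m. (- 1) ^ j * int ((2 * m - 1) choose (m - Suc j)) * fq (Suc j))"
  proof (intro sum.cong refl)
    fix j assume j: "j \<in> {..<m}"
    then have "m - (m - Suc j) = Suc j" by auto
    moreover have "(- 1 :: int) ^ (m - Suc j) = - ((- 1) ^ j)"
      using j even_m by (cases "even j") auto
    ultimately show "- (b (m - Suc j) * fq (m - (m - Suc j))) = (- 1) ^ j * int ((2 * m - 1) choose (m - Suc j)) * fq (Suc j)"
      by (simp add: b_def)
  qed
  finally have 3: "(\<Sum>k<m. G k) = \<dots>" .
  have 4: "(\<Sum>k<m. G (m + k)) = (\<Sum>j<m. (- 1) ^ j * int ((2 * m - 1) choose (m - Suc j)) * fq (Suc j))"
  proof (intro sum.cong refl)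
    fix j assume "j \<in> {..<m}"
    then have j: "j < m" by simp
    then have "2 * m - 1 - (m + j) = m - Suc j" by auto
    then have "(2 * m - 1) choose (m + j) = (2 * m - 1) choose (m - Suc j)"
      using binomial_symmetric[of "m + j" "2 * m - 1"] j by simp
    then show "G (m + j) = (- 1) ^ j * int ((2 * m - 1) choose (m - Suc j)) * fq (Suc j)"
      unfolding G2[OF j] b_def using even_m by (simp add: power_add)
  qed
  show ?thesis using 2 unfolding 1 sum_lessThan_add 3 4 by simp
qed

text \<open>Since \<open>p = 3 * m + 1\<close>, reflecting \<open>i\<close> to \<open>p - i\<close>
  maps \<open>m + 1..2 * m\<close> to itself, and \<open>1 / i + 1 / (p - i)\<close> is
  \<open>p\<close> times a p-integral number.\<close>

lemma harmonic_2m_pcong: "(\<Sum>i=1..m. 1 / of_nat i) - (\<Sum>i=1..2 * m. 1 / of_nat i) \<approx>[1] 0"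
proof -
  define T :: rat where "T = (\<Sum>i\<in>{m + 1..2 * m}. 1 / of_nat i)"
  have split: "(\<Sum>i=1..2 * m. 1 / of_nat i) = (\<Sum>i=1..m. 1 / of_nat i) + T"
    unfolding T_def by (subst sum.ub_add_nat[symmetric, of 1 m "\<lambda>i. 1 / of_nat i" m, unfolded mult_2[symmetric]]) simp_all
  have T_reflect: "T = (\<Sum>i\<in>{m + 1..2 * m}. 1 / of_nat (p - i))"
    unfolding T_def
    by (rule sum.reindex_bij_witness[of _ "\<lambda>i. p - i" "\<lambda>i. p - i"]) (auto simp: p_eq)
  have "T + T = of_nat p * (\<Sum>i\<in>{m + 1..2 * m}. 1 / of_nat i * (1 / of_nat (p - i)))"
    unfolding T_reflect[THEN arg_cong[of _ _ "(+) T"]] unfolding T_def sum.distrib[symmetric] sum_distrib_left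
  proof (intro sum.cong refl)
    fix i assume i: "i \<in> {m + 1..2 * m}"
    then have "(of_nat (p - i) :: rat) = of_nat p - of_nat i" "of_nat i \<noteq> (0 :: rat)" "of_nat (p - i) \<noteq> (0 :: rat)"
      using p_eq by (auto simp: of_nat_diff)
    then show "1 / of_nat i + 1 / of_nat (p - i) = (of_nat p * (1 / of_nat i * (1 / of_nat (p - i))) :: rat)"
      by (simp add: field_simps)
  qed
  moreover have "(\<Sum>i\<in>{m + 1..2 * m}. 1 / of_nat i * (1 / of_nat (p - i))) \<in> Zp"
    using p_eq by (intro Zp_sum Zp_mult Zp_inverse_less) auto
  ultimately have "2 * T \<approx>[1] 2 * 0"
    by (intro pcongI[of _ _ "\<Sum>i\<in>{m + 1..2 * m}. 1 / of_nat i * (1 / of_nat (p - i))"]) (auto intro: Zp_mult)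
  then have "T \<approx>[1] 0" by (rule pcong_cancel) auto
  then show ?thesis using pcong_uminus[of 1 T 0] unfolding split by simp
qed

text \<open>With \<open>s = Suc j\<close>, absorption turns \<open>2 * m\<close> times the binomial
  into \<open>(m + s) * C2 * central_ratio m s\<close>, and \<open>fq s\<close> is
  \<open>- 1 / s\<close>. The part with \<open>m / s\<close> vanishes by
  \<open>harmonic_2m_pcong\<close>; the rest is \<open>- C2 / 2\<close> by
  \<open>sum_central_ratio\<close>, and is doubled.\<close>

lemma correction_cong:
  "[2 * int m * (2 * (\<Sum>j<m. (- 1) ^ j * int ((2 * m - 1) choose (m - Suc j)) * fq (Suc j)))
     = - int ((2 * m) choose m)] (mod int p)"
proof -
  define C2 :: rat where "C2 = of_nat ((2 * m) choose m)"
  have step: "of_int (2 * int m * (- 1) ^ j * int ((2 * m - 1) choose (m - Suc j)))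
      = - C2 * (of_nat m * ((- 1) ^ Suc j * central_ratio m (Suc j)) + (- 1) ^ Suc j * of_nat (Suc j) * central_ratio m (Suc j))"
    if "j < m" for j
  proof -
    have "(2 * m - (m - Suc j)) * ((2 * m) choose (m - Suc j)) = 2 * m * ((2 * m - 1) choose (m - Suc j))"
      by (rule binomial_absorb_comp)
    moreover have "2 * m - (m - Suc j) = m + Suc j" using that by simp
    ultimately have "of_nat (2 * m) * of_nat ((2 * m - 1) choose (m - Suc j)) = (of_nat (m + Suc j) * of_nat ((2 * m) choose (m - Suc j)) :: rat)"
      by (metis of_nat_mult)
    also have "of_nat ((2 * m) choose (m - Suc j)) = C2 * central_ratio m (Suc j)"
      unfolding C2_def using that by (intro central_ratio_binomial) auto
    finally have e: "of_nat (2 * m) * of_nat ((2 * m - 1) choose (m - Suc j)) = of_nat (m + Suc j) * (C2 * central_ratio m (Suc j))" .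
    have "of_int (2 * int m * (- 1) ^ j * int ((2 * m - 1) choose (m - Suc j)))
        = (- 1) ^ j * (of_nat (2 * m) * of_nat ((2 * m - 1) choose (m - Suc j)) :: rat)"
      by simp
    also have "\<dots> = - C2 * (of_nat m * ((- 1) ^ Suc j * central_ratio m (Suc j)) + (- 1) ^ Suc j * of_nat (Suc j) * central_ratio m (Suc j))"
      unfolding e by (simp add: algebra_simps)
    finally show ?thesis .
  qed
  define D where "D s = - C2 * (of_nat m * ((- 1) ^ s * central_ratio m s) + (- 1) ^ s * of_nat s * central_ratio m s)" for s
  have "(\<Sum>j<m. of_int (2 * int m * (- 1) ^ j * int ((2 * m - 1) choose (m - Suc j))) * of_int (fq (Suc j)))
      \<approx>[1] (\<Sum>j<m. of_int (2 * int m * (- 1) ^ j * int ((2 * m - 1) choose (m - Suc j))) * - (1 / of_nat (Suc j)))"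
    using p_eq by (intro pcong_sum pcong_mult pcong_refl fq_pcong Zp_int) auto
  also have "\<dots> = (\<Sum>j<m. D (Suc j) * - (1 / of_nat (Suc j)))"
    using step unfolding D_def by (intro sum.cong) auto
  also have "\<dots> = (\<Sum>s=1..m. D s * - (1 / of_nat s))"
    by (simp add: sum.atLeast1_atMost_eq)
  also have "\<dots> = (\<Sum>s=1..m. C2 * (of_nat m * ((- 1) ^ s * central_ratio m s / of_nat s)) + C2 * ((- 1) ^ s * central_ratio m s))"
    unfolding D_def by (intro sum.cong) (auto simp: field_simps)
  also have "\<dots> = C2 * (of_nat m * ((\<Sum>i=1..m. 1 / of_nat i) - (\<Sum>i=1..2 * m. 1 / of_nat i))) + C2 * (- 1 / 2)"
    unfolding sum.distrib sum_distrib_left[symmetric] sum_central_ratio[OF m_pos] sum_central_ratio_harmonic ..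
  also have "\<dots> \<approx>[1] C2 * (of_nat m * 0) + C2 * (- 1 / 2)"
    using Zp_mult[OF Zp_nat[of "(2 * m) choose m"] Zp_half] Zp_uminus unfolding C2_def
    by (intro pcong_add pcong_mult harmonic_2m_pcong pcong_refl) auto
  finally have "2 * (\<Sum>j<m. of_int (2 * int m * (- 1) ^ j * int ((2 * m - 1) choose (m - Suc j))) * of_int (fq (Suc j)))
      \<approx>[1] 2 * (C2 * (of_nat m * 0) + C2 * (- 1 / 2))"
    by (intro pcong_mult[OF pcong_refl]) auto
  also have "2 * (C2 * (of_nat m * 0) + C2 * (- 1 / 2)) = of_int (- int ((2 * m) choose m))"
    by (simp add: C2_def)
  also have "2 * (\<Sum>j<m. of_int (2 * int m * (- 1) ^ j * int ((2 * m - 1) choose (m - Suc j))) * of_int (fq (Suc j)))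
     = (of_int (2 * int m * (2 * (\<Sum>j<m. (- 1) ^ j * int ((2 * m - 1) choose (m - Suc j)) * fq (Suc j)))) :: rat)"
    by (simp add: sum_distrib_left mult_ac)
  finally show ?thesis unfolding pcong_of_int_iff by simp
qed

text \<open>For \<open>t = teich x\<close>, the power \<open>(1 - t) ^ p\<close> is
  \<open>1 - t + p * Fq t\<close>, whose \<open>2 * m\<close>-th power is expanded to first order.
  The main term gives \<open>(p - 1) * C2\<close> and the correction \<open>- p * C2\<close>, so the
  multiples of \<open>p\<close> cancel.\<close>

lemma jacobi_unit_cong:
  "[(\<Sum>x\<in>{1..<int p}. (x * (1 - x)) ^ (2 * m * p)) = - int ((2 * m) choose m)] (mod int p ^ 2)"
proof -
  define C2 where "C2 = int ((2 * m) choose m)"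
  obtain n where n: "2 * m = Suc n" using m_pos by (cases "2 * m") auto
  have "[(\<Sum>x\<in>{1..<int p}. (x * (1 - x)) ^ (2 * m * p))
      = (\<Sum>x\<in>{1..<int p}. teich x ^ (2 * m) * (1 - teich x) ^ (2 * m)
          + int p * (int (2 * m) * (teich x ^ (2 * m) * (1 - teich x) ^ (2 * m - 1) * Fq (teich x))))] (mod int p ^ 2)"
  proof (rule cong_sum)
    fix x
    have "[x * (1 - x) = teich x * (1 - teich x)] (mod int p)"
      by (intro cong_mult cong_diff cong_refl cong_sym[OF teich_cong])
    then have "[(x * (1 - x)) ^ p = (teich x * (1 - teich x)) ^ p] (mod int p ^ 2)"
      by (rule cong_power_p_lift)
    also have "(teich x * (1 - teich x)) ^ p = teich x ^ p * (1 - teich x) ^ p"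
      by (rule power_mult_distrib)
    finally have 1: "[(x * (1 - x)) ^ p = teich x ^ p * (1 - teich x) ^ p] (mod int p ^ 2)" .
    have 2: "[teich x ^ p * (1 - teich x) ^ p = teich x * ((1 - teich x) + int p * Fq (teich x))] (mod int p ^ 2)"
      by (intro cong_mult teich_power_p power_p_one_minus)
    have 3: "[((x * (1 - x)) ^ p) ^ (2 * m) = (teich x * ((1 - teich x) + int p * Fq (teich x))) ^ (2 * m)] (mod int p ^ 2)"
      by (rule cong_pow[OF cong_trans[OF 1 2]])
    have 4: "[teich x ^ (2 * m) * ((1 - teich x) + int p * Fq (teich x)) ^ (2 * m)
        = teich x ^ (2 * m) * ((1 - teich x) ^ (2 * m) + int p * (int (2 * m) * Fq (teich x) * (1 - teich x) ^ (2 * m - 1)))] (mod int p ^ 2)"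
      unfolding n diff_Suc_1 by (rule cong_scalar_left[OF cong_power_add_multiple])
    have "((x * (1 - x)) ^ p) ^ (2 * m) = (x * (1 - x)) ^ (2 * m * p)"
      by (simp add: power_mult[symmetric] mult.commute)
    with cong_trans[OF 3 4[folded power_mult_distrib]]
    show "[(x * (1 - x)) ^ (2 * m * p) = teich x ^ (2 * m) * (1 - teich x) ^ (2 * m)
          + int p * (int (2 * m) * (teich x ^ (2 * m) * (1 - teich x) ^ (2 * m - 1) * Fq (teich x)))] (mod int p ^ 2)"
      by (simp add: algebra_simps)
  qed
  moreover have "(\<Sum>x\<in>{1..<int p}. teich x ^ (2 * m) * (1 - teich x) ^ (2 * m)
          + int p * (int (2 * m) * (teich x ^ (2 * m) * (1 - teich x) ^ (2 * m - 1) * Fq (teich x))))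
     = (\<Sum>x\<in>{1..<int p}. teich x ^ (2 * m) * (1 - teich x) ^ (2 * m))
       + int p * (int (2 * m) * (\<Sum>x\<in>{1..<int p}. teich x ^ (2 * m) * (1 - teich x) ^ (2 * m - 1) * Fq (teich x)))"
    by (simp only: sum.distrib sum_distrib_left)
  moreover have "[int p * (int (2 * m) * (\<Sum>x\<in>{1..<int p}. teich x ^ (2 * m) * (1 - teich x) ^ (2 * m - 1) * Fq (teich x)))
      = int p * - C2] (mod int p ^ 2)"
    using cong_trans[OF cong_scalar_left[OF sum_teich_correction, of "int (2 * m)"]] correction_cong
    by (intro cong_p_mult) (simp add: C2_def)
  then have "[(\<Sum>x\<in>{1..<int p}. teich x ^ (2 * m) * (1 - teich x) ^ (2 * m))
       + int p * (int (2 * m) * (\<Sum>x\<in>{1..<int p}. teich x ^ (2 * m) * (1 - teich x) ^ (2 * m - 1) * Fq (teich x)))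
      = (int p - 1) * C2 + int p * - C2] (mod int p ^ 2)"
    unfolding C2_def by (intro cong_add sum_teich_main_term)
  ultimately have "[(\<Sum>x\<in>{1..<int p}. (x * (1 - x)) ^ (2 * m * p)) = (int p - 1) * C2 + int p * - C2] (mod int p ^ 2)"
    by (metis (no_types, lifting) cong_trans)
  also have "(int p - 1) * C2 + int p * - C2 = - C2" by (simp add: algebra_simps)
  finally show ?thesis unfolding C2_def .
qed

end

section \<open>Cubic Jacobi sums\<close>

text \<open>\<open>z\<close> and \<open>w\<close> satisfy the same quadratic relation, modulo
  \<open>p^2\<close> and in the complex numbers, so \<open>z\<close> serves as the image of
  \<open>w\<close>.\<close>

locale cubic_character = prime_1_mod_3 +
  fixes z :: int and w :: complex
  assumes z: "[z ^ 2 + z + 1 = 0] (mod int p ^ 2)"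
    and w: "w ^ 2 + w + 1 = 0"
begin

section \<open>Arithmetic of w and z\<close>

lemma w2: "w ^ 2 = - 1 - w" and w3: "w ^ 3 = 1"
proof -
  show w2: "w ^ 2 = - 1 - w" using w by (simp add: eq_diff_eq add_eq_0_iff algebra_simps)
  have "w ^ 3 = w * w ^ 2" by (simp add: power3_eq_cube power2_eq_square)
  also have "\<dots> = - w - w ^ 2" unfolding w2 by (simp add: algebra_simps power2_eq_square[symmetric] w2)
  finally show "w ^ 3 = 1" unfolding w2 by simp
qed

lemma eisenstein_norm: "(a + b * w) * (a + b * w ^ 2) = a ^ 2 - a * b + b ^ 2"
proof -
  have "(a + b * w) * (a + b * w ^ 2) = a ^ 2 + a * b * (w ^ 2 + w) + b ^ 2 * w ^ 3"
    by (simp add: algebra_simps power2_eq_square power3_eq_cube)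
  also have "w ^ 2 + w = - 1" by (simp add: w2)
  finally show ?thesis by (simp add: w3)
qed

text \<open>The norm form is positive definite: four times it is
  \<open>(2 * a - b) ^ 2 + 3 * b ^ 2\<close>.\<close>

lemma eisenstein_eq_0:
  assumes "of_int a + of_int b * w = 0" shows "a = 0 \<and> b = 0"
proof -
  have "of_int (a ^ 2 - a * b + b ^ 2) = (0 :: complex)"
    using eisenstein_norm[of "of_int a" "of_int b"] assms by simp
  then have "a ^ 2 - a * b + b ^ 2 = 0" by (simp only: of_int_eq_0_iff)
  moreover have "4 * (a ^ 2 - a * b + b ^ 2) = (2 * a - b) ^ 2 + 3 * b ^ 2"
    by (simp add: power2_eq_square algebra_simps)
  ultimately have "(2 * a - b) ^ 2 + 3 * b ^ 2 = 0" by simp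
  moreover have "(2 * a - b) ^ 2 \<ge> 0" "b ^ 2 \<ge> 0" by simp_all
  ultimately have "(2 * a - b) ^ 2 = 0" "b ^ 2 = 0" by linarith+
  then show ?thesis by simp
qed

lemma w_neq_1: "w \<noteq> 1" "w ^ 2 \<noteq> 1"
proof -
  show "w \<noteq> 1" using eisenstein_eq_0[of "-1" 1] by auto
  show "w ^ 2 \<noteq> 1"
  proof
    assume "w ^ 2 = 1"
    then have "of_int 2 + of_int 1 * w = 0" unfolding w2 by (simp add: diff_eq_eq)
    then show False using eisenstein_eq_0[of 2 1] by simp
  qed
qed

lemma w4: "(w ^ 2) ^ 2 = w"
proof -
  have "(w ^ 2) ^ 2 = w * w ^ 3" by (simp add: power2_eq_square power3_eq_cube)
  then show ?thesis by (simp add: w3)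
qed

lemma z3: "[z ^ (3 * k) = 1] (mod int p)"
  using cube_root_of_unity(1)[OF z] by (rule cong_mod_p_of_mod_p2)

lemma z2: "[z ^ 2 = - 1 - z] (mod int p ^ 2)"
proof -
  have "z ^ 2 + z + 1 = z ^ 2 - (- 1 - z)" by simp
  then show ?thesis using z by (metis cong_iff_dvd_diff diff_zero)
qed

lemma z_not_1: "\<not> [z = 1] (mod int p)"
proof
  assume *: "[z = 1] (mod int p)"
  have "[z ^ 2 + z + 1 = 1 ^ 2 + 1 + 1] (mod int p)"
    by (intro cong_add cong_pow * cong_refl)
  then have "[3 = 0] (mod int p)" using cong_mod_p_of_mod_p2[OF z] by (simp add: cong_def)
  then have "int p dvd 3" by (simp add: cong_iff_dvd_diff)
  then show False using p_gt3 by (auto dest: zdvd_imp_le)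
qed

text \<open>1, \<open>z\<close> and \<open>z ^ 2\<close> are distinct modulo \<open>p\<close>, so
  the exponents agree modulo 3. This moves identities between residues to the complex values of the
  character.\<close>

lemma z_power_eq_imp:
  assumes "[z ^ a = z ^ b] (mod int p)" shows "w ^ a = w ^ b"
proof -
  have red: "[z ^ n = z ^ (n mod 3)] (mod int p)" for n
    using cong_scalar_right[OF z3[of "n div 3"], of "z ^ (n mod 3)"]
    by (simp add: power_add[symmetric])
  have "[z ^ (a mod 3) = z ^ (b mod 3)] (mod int p)"
    using assms red cong_sym cong_trans by blast
  moreover have "\<not> [z ^ 2 = 1] (mod int p)" "\<not> [z ^ 2 = z] (mod int p)"
  proof -
    show "\<not> [z ^ 2 = 1] (mod int p)"
    proof
      assume "[z ^ 2 = 1] (mod int p)"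
      then have "[z * z ^ 2 = z * 1] (mod int p)" by (rule cong_scalar_left)
      then have "[z ^ 3 = z] (mod int p)" by (simp add: power3_eq_cube power2_eq_square mult.assoc)
      with z3[of 1] z_not_1 show False by (simp add: cong_def)
    qed
    show "\<not> [z ^ 2 = z] (mod int p)"
    proof
      assume "[z ^ 2 = z] (mod int p)"
      then have "[z ^ 2 * z ^ 2 = z ^ 2 * z] (mod int p)" by (rule cong_scalar_left)
      then have "[z ^ 3 * z = z ^ 3] (mod int p)" by (simp add: power3_eq_cube power2_eq_square mult.assoc)
      moreover have "[z ^ 3 * z = 1 * z] (mod int p)" using z3[of 1] by (intro cong_scalar_right) simp
      ultimately show False using z3[of 1] z_not_1 by (simp add: cong_def)
    qed
  qed
  moreover have "a mod 3 \<in> {0, 1, 2}" "b mod 3 \<in> {0, 1, 2}" by auto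
  ultimately have ab: "a mod 3 = b mod 3"
    using z_not_1 by (auto simp: cong_sym_eq)
  have "w ^ n = w ^ (n mod 3)" for n
  proof -
    have "w ^ n = w ^ (3 * (n div 3)) * w ^ (n mod 3)" by (simp add: power_add[symmetric])
    then show ?thesis by (simp add: power_mult w3)
  qed
  then show ?thesis using ab by metis
qed

text \<open>A discrete logarithm of \<open>x ^ m\<close> to base \<open>z\<close>. Multiples of
  \<open>p\<close> receive the default 2, which \<open>chi\<close> overrides by 0.\<close>

definition idx :: "int \<Rightarrow> nat" where
  "idx x = (if [x ^ m = 1] (mod int p) then 0 else if [x ^ m = z] (mod int p) then 1 else 2)"

lemma idx_less: "idx x = 0 \<or> idx x = 1 \<or> idx x = 2"
  by (simp add: idx_def)

text \<open>Modulo \<open>p\<close>, \<open>y = x ^ m\<close> is a root of \<open>y ^ 3 - 1\<close>,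
  which factors as \<open>(y - 1) * (y - z) * (y - z ^ 2)\<close>.\<close>

lemma idx_cong:
  assumes "\<not> int p dvd x" shows "[x ^ m = z ^ idx x] (mod int p)"
proof -
  define y where "y = x ^ m"
  have "[y ^ 3 = 1] (mod int p)"
    using power_p_minus_1_cong_1[OF assms] p_eq by (simp add: y_def power_mult[symmetric] mult.commute)
  moreover have "(y - 1) * ((y - z) * (y - z ^ 2)) = (y ^ 3 - 1) - (z ^ 2 + z + 1) * (y ^ 2 - y) + (y - 1) * (z ^ 3 - 1)"
    by (simp add: algebra_simps power2_eq_square power3_eq_cube)
  moreover have "int p dvd z ^ 3 - 1" using z3[of 1] by (simp add: cong_iff_dvd_diff)
  moreover have "int p dvd z ^ 2 + z + 1" using cong_mod_p_of_mod_p2[OF z] by (simp add: cong_iff_dvd_diff)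
  ultimately have "int p dvd (y - 1) * ((y - z) * (y - z ^ 2))"
    by (simp add: cong_iff_dvd_diff)
  then have "int p dvd y - 1 \<or> int p dvd y - z \<or> int p dvd y - z ^ 2"
    using prime_dvd_mult_iff[OF prime_int_p] by blast
  then show ?thesis by (auto simp: idx_def y_def cong_iff_dvd_diff)
qed

definition chi :: "int \<Rightarrow> complex" where
  "chi x = (if int p dvd x then 0 else w ^ idx x)"

lemma chi_cong: "[x = y] (mod int p) \<Longrightarrow> chi x = chi y"
proof -
  assume *: "[x = y] (mod int p)"
  then have "[x ^ m = y ^ m] (mod int p)" by (rule cong_pow)
  then have "[x ^ m = a] (mod int p) \<longleftrightarrow> [y ^ m = a] (mod int p)" for a by (simp add: cong_def)
  then have "idx x = idx y" unfolding idx_def by (simp only:)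
  moreover have "int p dvd x \<longleftrightarrow> int p dvd y" using * by (rule cong_dvd_iff)
  ultimately show ?thesis by (simp add: chi_def)
qed

lemma chi_0 [simp]: "chi 0 = 0" by (simp add: chi_def)

lemma chi_1 [simp]: "chi 1 = 1"
  using p_gt3 by (simp add: chi_def idx_def)

text \<open>\<open>idx\<close> is additive only modulo 3, so exponents are compared as powers of
  \<open>z\<close> and carried to \<open>w\<close> by \<open>z_power_eq_imp\<close>.\<close>

lemma chi_mult: "chi (x * y) = chi x * chi y"
proof (cases "int p dvd x \<or> int p dvd y")
  case False
  then have n: "\<not> int p dvd x * y" using prime_dvd_mult_iff[OF prime_int_p] by blast
  have "[z ^ idx (x * y) = (x * y) ^ m] (mod int p)" using idx_cong[OF n] by (rule cong_sym)
  also have "(x * y) ^ m = x ^ m * y ^ m" by (rule power_mult_distrib)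
  finally have "[z ^ idx (x * y) = x ^ m * y ^ m] (mod int p)" .
  moreover have "[x ^ m * y ^ m = z ^ idx x * z ^ idx y] (mod int p)"
    using False by (intro cong_mult idx_cong) auto
  ultimately have "[z ^ idx (x * y) = z ^ (idx x + idx y)] (mod int p)"
    unfolding power_add by (rule cong_trans)
  from z_power_eq_imp[OF this] show ?thesis using n False by (simp add: chi_def power_add)
qed (auto simp: chi_def)

lemma chi_cube: "\<not> int p dvd x \<Longrightarrow> chi x * chi x ^ 2 = 1"
proof -
  assume *: "\<not> int p dvd x"
  have "chi x * chi x ^ 2 = (w ^ idx x) ^ 3" using * by (simp add: chi_def power3_eq_cube power2_eq_square)
  also have "\<dots> = (w ^ 3) ^ idx x" by (simp add: power_mult[symmetric] mult.commute)
  finally show ?thesis by (simp add: w3)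
qed

lemma not_dvd_range: "x \<in> {1..<int p} \<Longrightarrow> \<not> int p dvd x"
  by (auto dest: zdvd_imp_le)

lemma cong_mod_self: "[x mod int p = x] (mod int p)"
  by simp

text \<open>Scaling by a primitive root \<open>g\<close> multiplies the sums by \<open>chi g\<close>
  and \<open>chi g ^ 2\<close>, both different from 1.\<close>

lemma sum_chi: "(\<Sum>x\<in>{0..<int p}. chi x) = 0" and sum_chi_sq: "(\<Sum>x\<in>{0..<int p}. chi x ^ 2) = 0"
proof -
  obtain g :: int where g: "\<not> int p dvd g" "\<And>k. [g ^ k = 1] (mod int p) \<longleftrightarrow> (p - 1) dvd k"
    by (rule obtain_primroot) blast
  have "\<not> (p - 1) dvd m" using p_eq m_pos by (auto dest: dvd_imp_le)
  then have "idx g = 1 \<or> idx g = 2" using g(2) by (simp add: idx_def)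
  then have ne: "chi g \<noteq> 1" "chi g ^ 2 \<noteq> 1"
    using g(1) w_neq_1 w4 by (auto simp: chi_def)
  have "(\<Sum>x\<in>{0..<int p}. chi (g * x + 0)) = (\<Sum>x\<in>{0..<int p}. chi x)"
    using g(1) by (intro sum_residues_affine chi_cong cong_mod_self)
  then have "(chi g - 1) * (\<Sum>x\<in>{0..<int p}. chi x) = 0"
    by (simp add: chi_mult sum_distrib_left[symmetric] left_diff_distrib)
  then show "(\<Sum>x\<in>{0..<int p}. chi x) = 0" using ne by simp
  have "(\<Sum>x\<in>{0..<int p}. chi (g * x + 0) ^ 2) = (\<Sum>x\<in>{0..<int p}. chi x ^ 2)"
    using g(1) chi_cong[OF cong_mod_self] by (intro sum_residues_affine) auto
  then have "(chi g ^ 2 - 1) * (\<Sum>x\<in>{0..<int p}. chi x ^ 2) = 0"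
    by (simp add: chi_mult power_mult_distrib sum_distrib_left[symmetric] left_diff_distrib)
  then show "(\<Sum>x\<in>{0..<int p}. chi x ^ 2) = 0" using ne by simp
qed

lemma sum_chi_affine:
  assumes "\<not> int p dvd a" shows "(\<Sum>c\<in>{1..<int p}. chi (a * c + s)) = - chi s"
proof -
  have "(\<Sum>c\<in>{0..<int p}. chi (a * c + s)) = (\<Sum>x\<in>{0..<int p}. chi x)"
    using assms by (intro sum_residues_affine chi_cong cong_mod_self)
  then have "chi s + (\<Sum>c\<in>{1..<int p}. chi (a * c + s)) = 0"
    unfolding sum_chi by (simp add: sum_residues_0)
  then show ?thesis by (simp add: add_eq_0_iff)
qed

text \<open>Averaging over the scaling \<open>u \<mapsto> c * u\<close> replaces the substitution \<open>u \<mapsto> 1 / u\<close>.\<close>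

lemma sum_chi_affine_chi_sq:
  assumes "\<not> int p dvd a" shows "(\<Sum>u\<in>{1..<int p}. chi (a + s * u) * chi u ^ 2) = - chi s"
proof -
  let ?I = "{1..<int p}"
  have per1: "chi (c * a + s * (u mod int p)) * chi (u mod int p) ^ 2 = chi (c * a + s * u) * chi u ^ 2" for c u
  proof -
    have "chi (c * a + s * (u mod int p)) = chi (c * a + s * u)"
      by (intro chi_cong cong_add cong_mult cong_mod_self cong_refl)
    then show ?thesis using chi_cong[OF cong_mod_self, of u] by simp
  qed
  have "of_nat (p - 1) * (\<Sum>u\<in>?I. chi (a + s * u) * chi u ^ 2)
      = (\<Sum>c\<in>?I. \<Sum>u\<in>?I. chi (a + s * u) * chi u ^ 2)"
    using p_gt3 by (simp add: of_nat_diff)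
  also have "\<dots> = (\<Sum>c\<in>?I. \<Sum>u\<in>?I. chi (c * a + s * (c * u)) * chi (c * u) ^ 2)"
  proof (intro sum.cong refl)
    fix c u assume "c \<in> ?I"
    then have "chi c * chi c ^ 2 = 1" using not_dvd_range chi_cube by blast
    moreover have "c * a + s * (c * u) = c * (a + s * u)" by (simp add: algebra_simps)
    then have "chi (c * a + s * (c * u)) * chi (c * u) ^ 2 = (chi c * chi c ^ 2) * (chi (a + s * u) * chi u ^ 2)"
      by (simp only: chi_mult power_mult_distrib mult_ac)
    ultimately show "chi (a + s * u) * chi u ^ 2 = chi (c * a + s * (c * u)) * chi (c * u) ^ 2" by simp
  qed
  also have "\<dots> = (\<Sum>c\<in>?I. \<Sum>u\<in>?I. chi (c * a + s * u) * chi u ^ 2)"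
  proof (rule sum.cong[OF refl])
    fix c assume "c \<in> ?I"
    then show "(\<Sum>u\<in>?I. chi (c * a + s * (c * u)) * chi (c * u) ^ 2) = (\<Sum>u\<in>?I. chi (c * a + s * u) * chi u ^ 2)"
      using per1 not_dvd_range by (intro sum_residues_mult[where f = "\<lambda>u. chi (c * a + s * u) * chi u ^ 2"]) auto
  qed
  also have "\<dots> = (\<Sum>u\<in>?I. \<Sum>c\<in>?I. chi (c * a + s * u) * chi u ^ 2)" by (rule sum.swap)
  \<comment> \<open>This second scaling, of \<open>c\<close> by \<open>u\<close>, pulls out a factor
    \<open>chi u\<close> that cancels against \<open>chi u ^ 2\<close>.\<close>
  also have "\<dots> = (\<Sum>u\<in>?I. \<Sum>c\<in>?I. chi (u * c * a + s * u) * chi u ^ 2)"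
  proof (rule sum.cong[OF refl])
    fix u assume u: "u \<in> ?I"
    have "chi (x mod int p * a + s * u) = chi (x * a + s * u)" for x
      by (intro chi_cong cong_add cong_mult cong_mod_self cong_refl)
    then show "(\<Sum>c\<in>?I. chi (c * a + s * u) * chi u ^ 2) = (\<Sum>c\<in>?I. chi (u * c * a + s * u) * chi u ^ 2)"
      using not_dvd_range[OF u]
      by (intro sum_residues_mult[where f = "\<lambda>c. chi (c * a + s * u) * chi u ^ 2", symmetric]) auto
  qed
  also have "\<dots> = (\<Sum>u\<in>?I. \<Sum>c\<in>?I. chi (a * c + s))"
  proof (intro sum.cong refl)
    fix u c assume "u \<in> ?I"
    then have "chi u * chi u ^ 2 = 1" using not_dvd_range chi_cube by blast
    moreover have "u * c * a + s * u = u * (a * c + s)" by (simp add: algebra_simps)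
    then have "chi (u * c * a + s * u) * chi u ^ 2 = (chi u * chi u ^ 2) * chi (a * c + s)"
      by (simp only: chi_mult mult_ac)
    ultimately show "chi (u * c * a + s * u) * chi u ^ 2 = chi (a * c + s)" by simp
  qed
  also have "\<dots> = of_nat (p - 1) * - chi s"
    unfolding sum_chi_affine[OF assms] using p_gt3 by (simp add: of_nat_diff)
  finally show ?thesis
    using p_gt3 by (subst (asm) mult_left_cancel) auto
qed

section \<open>The Jacobi sum, its norm and its coordinates\<close>

definition jacobi :: complex where "jacobi = (\<Sum>x\<in>{1..<int p}. chi x * chi (1 - x))"

text \<open>The complex conjugate of \<open>jacobi\<close>: squaring a cube root of unity conjugates
  it, which keeps the argument algebraic.\<close>

definition jacobi_conj :: complex where "jacobi_conj = (\<Sum>x\<in>{1..<int p}. chi x ^ 2 * chi (1 - x) ^ 2)"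

lemma inner_sum:
  assumes "s \<in> {1..<int p}"
  shows "(\<Sum>y\<in>{1..<int p}. chi (1 - s * y) * chi (1 - y) ^ 2) = (if s = 1 then of_nat p - 2 else - chi s - 1)"
proof -
  define f where "f u = chi (1 - s + s * u) * chi u ^ 2" for u
  have per: "f (u mod int p) = f u" for u
  proof -
    have "chi (1 - s + s * (u mod int p)) = chi (1 - s + s * u)"
      by (intro chi_cong cong_add cong_mult cong_mod_self cong_refl)
    then show ?thesis using chi_cong[OF cong_mod_self, of u] by (simp add: f_def)
  qed
  \<comment> \<open>The missing \<open>y = 0\<close> contributes 1; adding it completes the residue
    system, so that \<open>u = 1 - y\<close> can be substituted.\<close>
  have "1 + (\<Sum>y\<in>{1..<int p}. chi (1 - s * y) * chi (1 - y) ^ 2) = (\<Sum>y\<in>{0..<int p}. chi (1 - s * y) * chi (1 - y) ^ 2)"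
    by (simp add: sum_residues_0)
  also have "\<dots> = (\<Sum>y\<in>{0..<int p}. f (- 1 * y + 1))"
    unfolding f_def by (intro sum.cong refl arg_cong2[of _ _ _ _ "(*)"] arg_cong[of _ _ chi] arg_cong[of _ _ "\<lambda>u. chi u ^ 2"])
      (simp_all add: algebra_simps)
  also have "\<dots> = (\<Sum>u\<in>{0..<int p}. f u)"
    using p_gt3 by (intro sum_residues_affine per) auto
  also have "\<dots> = (\<Sum>u\<in>{1..<int p}. f u)"
    by (simp add: sum_residues_0 f_def)
  also have "\<dots> = (if s = 1 then of_nat p - 1 else - chi s)"
  proof (cases "s = 1")
    case True
    then have "(\<Sum>u\<in>{1..<int p}. f u) = (\<Sum>u\<in>{1..<int p}. 1)"
      using chi_cube not_dvd_range by (intro sum.cong) (auto simp: f_def)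
    then show ?thesis using True p_gt3 by (simp add: of_nat_diff)
  next
    case False
    have "\<not> int p dvd s - 1" using False assms by (auto dest: zdvd_imp_le)
    then have "\<not> int p dvd 1 - s" by (simp add: dvd_diff_commute)
    then show ?thesis using False unfolding f_def by (simp add: sum_chi_affine_chi_sq)
  qed
  finally show ?thesis by (auto simp: algebra_simps split: if_splits)
qed

text \<open>Substituting \<open>x = y * s\<close> makes \<open>chi y * chi y ^ 2 = 1\<close> drop
  out and leaves \<open>chi s\<close> times \<open>inner_sum\<close>. The sums of \<open>chi\<close>
  and \<open>chi ^ 2\<close> vanish, and \<open>s = 1\<close> supplies \<open>p\<close>.\<close>

lemma jacobi_norm: "jacobi * jacobi_conj = of_nat p"
proof -
  let ?I = "{1..<int p}"
  have "jacobi * jacobi_conj = (\<Sum>y\<in>?I. \<Sum>x\<in>?I. chi x * chi (1 - x) * (chi y ^ 2 * chi (1 - y) ^ 2))"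
    unfolding jacobi_def jacobi_conj_def sum_product by (rule sum.swap)
  also have "\<dots> = (\<Sum>y\<in>?I. \<Sum>s\<in>?I. chi (y * s) * chi (1 - y * s) * (chi y ^ 2 * chi (1 - y) ^ 2))"
  proof (rule sum.cong[OF refl])
    fix y assume y: "y \<in> ?I"
    have "chi (x mod int p) * chi (1 - x mod int p) = chi x * chi (1 - x)" for x
      by (intro arg_cong2[of _ _ _ _ "(*)"] chi_cong cong_diff cong_mod_self cong_refl)
    then show "(\<Sum>x\<in>?I. chi x * chi (1 - x) * (chi y ^ 2 * chi (1 - y) ^ 2))
        = (\<Sum>s\<in>?I. chi (y * s) * chi (1 - y * s) * (chi y ^ 2 * chi (1 - y) ^ 2))"
      using not_dvd_range[OF y]
      by (intro sum_residues_mult[where f = "\<lambda>x. chi x * chi (1 - x) * (chi y ^ 2 * chi (1 - y) ^ 2)", symmetric]) auto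
  qed
  also have "\<dots> = (\<Sum>y\<in>?I. \<Sum>s\<in>?I. chi s * (chi (1 - s * y) * chi (1 - y) ^ 2))"
  proof (intro sum.cong refl)
    fix y s assume "y \<in> ?I"
    then have "chi y * chi y ^ 2 = 1" using not_dvd_range chi_cube by blast
    moreover have "chi (y * s) * chi (1 - y * s) * (chi y ^ 2 * chi (1 - y) ^ 2)
        = (chi y * chi y ^ 2) * (chi s * (chi (1 - s * y) * chi (1 - y) ^ 2))"
      by (simp only: chi_mult mult_ac)
    ultimately show "chi (y * s) * chi (1 - y * s) * (chi y ^ 2 * chi (1 - y) ^ 2)
        = chi s * (chi (1 - s * y) * chi (1 - y) ^ 2)" by simp
  qed
  also have "\<dots> = (\<Sum>s\<in>?I. chi s * (\<Sum>y\<in>?I. chi (1 - s * y) * chi (1 - y) ^ 2))"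
    by (subst sum.swap) (simp add: sum_distrib_left)
  also have "\<dots> = (\<Sum>s\<in>?I. (if s = 1 then of_nat p else 0) - chi s ^ 2 - chi s)"
    using inner_sum by (intro sum.cong refl) (auto simp: algebra_simps power2_eq_square)
  also have "\<dots> = of_nat p - (\<Sum>s\<in>?I. chi s ^ 2) - (\<Sum>s\<in>?I. chi s)"
    using p_gt3 by (simp add: sum_subtractf)
  also have "\<dots> = of_nat p"
    using sum_chi sum_chi_sq by (simp add: sum_residues_0)
  finally show ?thesis .
qed

text \<open>\<open>re_idx\<close> and \<open>om_idx\<close> are the coordinates of
  \<open>chi\<close> with respect to 1 and \<open>w\<close>; index 2 gives -1 in both because
  \<open>w ^ 2 = - 1 - w\<close>.\<close>

definition re_idx :: "int \<Rightarrow> int" where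
  "re_idx y = (if int p dvd y then 0 else if idx y = 0 then 1 else if idx y = 1 then 0 else - 1)"

definition om_idx :: "int \<Rightarrow> int" where
  "om_idx y = (if int p dvd y then 0 else if idx y = 0 then 0 else if idx y = 1 then 1 else - 1)"

definition A :: int where "A = (\<Sum>x\<in>{1..<int p}. re_idx (x * (1 - x)))"

definition B :: int where "B = (\<Sum>x\<in>{1..<int p}. om_idx (x * (1 - x)))"

lemma chi_eisenstein: "chi y = of_int (re_idx y) + of_int (om_idx y) * w"
  and chi_sq_eisenstein: "chi y ^ 2 = of_int (re_idx y) + of_int (om_idx y) * w ^ 2"
proof -
  show "chi y = of_int (re_idx y) + of_int (om_idx y) * w"
    using idx_less[of y] w2 by (auto simp: chi_def re_idx_def om_idx_def)
  have "(w ^ 2) ^ 2 = - 1 - w ^ 2" unfolding w4 by (simp add: w2)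
  then show "chi y ^ 2 = of_int (re_idx y) + of_int (om_idx y) * w ^ 2"
    using idx_less[of y] by (auto simp: chi_def re_idx_def om_idx_def)
qed

lemma jacobi_eisenstein: "jacobi = of_int A + of_int B * w"
  and jacobi_conj_eisenstein: "jacobi_conj = of_int A + of_int B * w ^ 2"
  unfolding jacobi_def jacobi_conj_def A_def B_def of_int_sum sum_distrib_right sum.distrib[symmetric]
    chi_eisenstein[symmetric] chi_sq_eisenstein[symmetric] chi_mult power_mult_distrib
  by simp_all

lemma norm_A_B: "A ^ 2 - A * B + B ^ 2 = int p"
proof -
  have "(of_int (A ^ 2 - A * B + B ^ 2) :: complex) = of_int (int p)"
    using jacobi_norm unfolding jacobi_eisenstein jacobi_conj_eisenstein eisenstein_norm by simp
  then show ?thesis by (simp only: of_int_eq_iff)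
qed

text \<open>Since \<open>(w - 1)\<^sup>2 = - 3 * w\<close>, every summand of
  \<open>jacobi + p = (\<Sum>x. (chi x - 1) * (chi (1 - x) - 1))\<close> is divisible by 3.\<close>

lemma A_B_mod_3: "3 dvd A + int p" "3 dvd B"
proof -
  have prod: "\<exists>c d. (chi x - 1) * (chi y - 1) = 3 * (of_int c + of_int d * w)"
    if "\<not> int p dvd x" "\<not> int p dvd y" for x y
  proof -
    have ww: "w * w = - 1 - w" using w2 by (simp add: power2_eq_square)
    have "(w - 1) * (w - 1) = 3 * (of_int 0 + of_int (- 1) * w)"
      by (simp add: algebra_simps ww)
    moreover have "(w - 1) * (w ^ 2 - 1) = 3 * (of_int 1 + of_int 0 * w)"
      unfolding w2 by (simp add: algebra_simps ww)
    moreover have "(w ^ 2 - 1) * (w ^ 2 - 1) = 3 * (of_int 1 + of_int 1 * w)"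
      unfolding w2 by (simp add: algebra_simps ww)
    moreover have "0 = 3 * (of_int 0 + of_int 0 * w)" by simp
    moreover have "chi x = 1 \<or> chi x = w \<or> chi x = w ^ 2" "chi y = 1 \<or> chi y = w \<or> chi y = w ^ 2"
      using that idx_less[of x] idx_less[of y] by (auto simp: chi_def)
    ultimately show ?thesis by (metis diff_self mult.commute mult_zero_left)
  qed
  have "\<exists>c d. (\<Sum>x\<in>I. (chi x - 1) * (chi (1 - x) - 1)) = 3 * (of_int c + of_int d * w)"
    if "I \<subseteq> {0..<int p}" for I
    using finite_subset[OF that finite_atLeastLessThan_int] that
  proof (induction I rule: finite_induct)
    case empty
    have "(0 :: complex) = 3 * (of_int 0 + of_int 0 * w)" by simp
    then show ?case by (metis sum.empty)
  next
    case (insert x I)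
    then obtain c d where cd: "(\<Sum>x\<in>I. (chi x - 1) * (chi (1 - x) - 1)) = 3 * (of_int c + of_int d * w)" by auto
    have "\<exists>c d. (chi x - 1) * (chi (1 - x) - 1) = 3 * (of_int c + of_int d * w)"
    proof (cases "x = 0 \<or> x = 1")
      case True
      then have "(chi x - 1) * (chi (1 - x) - 1) = 3 * (of_int 0 + of_int 0 * w)" by auto
      then show ?thesis by blast
    next
      case False
      then have "\<not> int p dvd x" "\<not> int p dvd x - 1"
        using insert.prems by (auto dest: zdvd_imp_le)
      then show ?thesis by (intro prod) (auto simp: dvd_diff_commute)
    qed
    then obtain c' d' where "(chi x - 1) * (chi (1 - x) - 1) = 3 * (of_int c' + of_int d' * w)" by auto
    then have "(\<Sum>x\<in>insert x I. (chi x - 1) * (chi (1 - x) - 1)) = 3 * (of_int (c + c') + of_int (d + d') * w)"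
      using insert.hyps cd by (simp add: algebra_simps)
    then show ?case by blast
  qed
  then obtain c d where cd: "(\<Sum>x\<in>{0..<int p}. (chi x - 1) * (chi (1 - x) - 1)) = 3 * (of_int c + of_int d * w)" by blast
  have "(\<Sum>x\<in>{0..<int p}. chi (- 1 * x + 1)) = (\<Sum>x\<in>{0..<int p}. chi x)"
    using p_gt3 by (intro sum_residues_affine chi_cong cong_mod_self) auto
  then have refl: "(\<Sum>x\<in>{0..<int p}. chi (1 - x)) = 0" by (simp add: sum_chi)
  have "(\<Sum>x\<in>{0..<int p}. (chi x - 1) * (chi (1 - x) - 1))
      = (\<Sum>x\<in>{0..<int p}. chi x * chi (1 - x)) - (\<Sum>x\<in>{0..<int p}. chi x) - (\<Sum>x\<in>{0..<int p}. chi (1 - x)) + (\<Sum>x\<in>{0..<int p}. 1)"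
    unfolding sum_subtractf[symmetric] sum.distrib[symmetric] by (intro sum.cong) (auto simp: algebra_simps)
  also have "\<dots> = jacobi + of_nat p"
    unfolding sum_chi refl jacobi_def by (simp add: sum_residues_0)
  finally have "of_int (A + int p - 3 * c) + of_int (B - 3 * d) * w = 0"
    using cd unfolding jacobi_eisenstein by (simp add: algebra_simps)
  from eisenstein_eq_0[OF this] show "3 dvd A + int p" "3 dvd B" by auto
qed

text \<open>The exponent is twice the one defining \<open>idx\<close>, so \<open>w\<close> is sent
  to \<open>z ^ 2 = - 1 - z\<close> and the right-hand side is the image of
  \<open>jacobi\<close>.\<close>

lemma unit_cong: "[(\<Sum>x\<in>{1..<int p}. (x * (1 - x)) ^ (2 * m * p)) = A - B - B * z] (mod int p ^ 2)"
proof -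
  have z4: "[z ^ 4 = z] (mod int p ^ 2)"
    using cong_scalar_left[OF cube_root_of_unity(1)[OF z, of 1], of z] by (simp add: eval_nat_numeral)
  have zp: "[(z ^ i) ^ p = z ^ i] (mod int p ^ 2)" for i
    using cong_pow[OF cube_root_of_unity(2)[OF z], of i] by (simp add: power_mult[symmetric] mult.commute)
  have "[y ^ (2 * m * p) = re_idx y + om_idx y * (- 1 - z)] (mod int p ^ 2)" for y
  proof (cases "int p dvd y")
    case True
    have "2 \<le> 2 * m * p" using m_pos p_gt3 by (cases m) auto
    then have "y ^ 2 dvd y ^ (2 * m * p)" by (rule le_imp_power_dvd)
    moreover have "int p ^ 2 dvd y ^ 2" using True by (rule dvd_power_same)
    ultimately have "int p ^ 2 dvd y ^ (2 * m * p)" by (rule dvd_trans[rotated])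
    then show ?thesis using True by (simp add: re_idx_def om_idx_def cong_iff_dvd_diff)
  next
    case False
    have "[(y ^ m) ^ p = (z ^ idx y) ^ p] (mod int p ^ 2)"
      by (intro cong_power_p_lift idx_cong False)
    then have "[(y ^ m) ^ p = z ^ idx y] (mod int p ^ 2)" using zp by (rule cong_trans)
    then have "[((y ^ m) ^ p) ^ 2 = (z ^ idx y) ^ 2] (mod int p ^ 2)" by (rule cong_pow)
    moreover have "((y ^ m) ^ p) ^ 2 = y ^ (2 * m * p)" by (simp add: power_mult[symmetric] mult_ac)
    moreover have "[(z ^ idx y) ^ 2 = re_idx y + om_idx y * (- 1 - z)] (mod int p ^ 2)"
      using idx_less[of y] False z2 z4 by (auto simp: re_idx_def om_idx_def power_mult[symmetric])
    ultimately show ?thesis by (metis cong_trans)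
  qed
  then have "[(\<Sum>x\<in>{1..<int p}. (x * (1 - x)) ^ (2 * m * p))
      = (\<Sum>x\<in>{1..<int p}. re_idx (x * (1 - x)) + om_idx (x * (1 - x)) * (- 1 - z))] (mod int p ^ 2)"
    by (intro cong_sum)
  also have "(\<Sum>x\<in>{1..<int p}. re_idx (x * (1 - x)) + om_idx (x * (1 - x)) * (- 1 - z)) = A - B - B * z"
    unfolding sum.distrib sum_distrib_right[symmetric] A_def[symmetric] B_def[symmetric] by (simp add: algebra_simps)
  finally show ?thesis .
qed

end

section \<open>The representation of 4p\<close>

context prime_1_mod_3
begin

text \<open>The \<open>p\<close>-th power lifts a cube root of unity to modulus \<open>p^2\<close>;
  as it is not 1 modulo \<open>p\<close>, the factor \<open>z - 1\<close> of
  \<open>z ^ 3 - 1\<close> is a unit and cancels.\<close>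

lemma obtain_cube_root:
  obtains z where "[z ^ 2 + z + 1 = 0] (mod int p ^ 2)"
proof -
  obtain g :: int where g: "\<not> int p dvd g" "\<And>k. [g ^ k = 1] (mod int p) \<longleftrightarrow> (p - 1) dvd k"
    by (rule obtain_primroot) blast
  define z where "z = (g ^ m) ^ p"
  have "[(g ^ (p - 1)) ^ p = 1 ^ p] (mod int p ^ 2)"
    using g by (intro cong_power_p_lift power_p_minus_1_cong_1)
  moreover have "(g ^ (p - 1)) ^ p = z ^ 3"
  proof -
    have "p - 1 = 3 * m" using p_eq by simp
    then show ?thesis by (simp add: z_def power_mult[symmetric] mult_ac)
  qed
  ultimately have "[z ^ 3 = 1] (mod int p ^ 2)" by simp
  moreover have "z ^ 3 - 1 = (z - 1) * (z ^ 2 + z + 1)"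
    by (simp add: algebra_simps power2_eq_square power3_eq_cube)
  ultimately have "int p ^ 2 dvd (z - 1) * (z ^ 2 + z + 1)" by (simp add: cong_iff_dvd_diff)
  moreover have "\<not> int p dvd z - 1"
  proof
    assume "int p dvd z - 1"
    then have "[z = 1] (mod int p)" by (simp add: cong_iff_dvd_diff)
    moreover have "[z = g ^ m] (mod int p)" unfolding z_def by (rule fermat_int)
    ultimately have "[g ^ m = 1] (mod int p)" by (meson cong_sym cong_trans)
    then have "(p - 1) dvd m" using g(2) by blast
    then show False using p_eq m_pos by (auto dest: dvd_imp_le)
  qed
  then have "coprime (int p ^ 2) (z - 1)" using prime_imp_coprime[OF prime_int_p] by simp
  ultimately have "int p ^ 2 dvd z ^ 2 + z + 1" by (simp add: coprime_dvd_mult_right_iff)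
  then show ?thesis by (intro that[of z]) (simp add: cong_iff_dvd_diff)
qed

text \<open>If \<open>4 * p = L\<^sup>2 + 27 * M\<^sup>2 = L'\<^sup>2 + 27 * M'\<^sup>2\<close> then \<open>p\<close> divides
  \<open>(L * M' - L' * M) * (L * M' + L' * M)\<close>, and
  \<open>(L * L' \<plusminus> 27 * M * M')\<^sup>2 + 27 * (L * M' \<mp> L' * M)\<^sup>2 = 16 * p\<^sup>2\<close> forces the divisible factor to vanish.\<close>

lemma representation_unique:
  fixes L M L' M' :: int
  assumes 1: "4 * int p = L ^ 2 + 27 * M ^ 2" and 2: "4 * int p = L' ^ 2 + 27 * M' ^ 2"
    and L: "[L = 1] (mod 3)" and L': "[L' = 1] (mod 3)"
  shows "L = L'"
proof -
  have vanish: "t = 0" if "s ^ 2 + 27 * t ^ 2 = 16 * int p ^ 2" "int p dvd t" for s t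
  proof (rule ccontr)
    assume "t \<noteq> 0"
    \<comment> \<open>A nonzero multiple \<open>t\<close> of \<open>p\<close> would make
      \<open>27 * t ^ 2\<close> exceed \<open>16 * p ^ 2\<close>.\<close>
    then have "int p \<le> \<bar>t\<bar>" using that(2) zdvd_imp_le[of "int p" "\<bar>t\<bar>"] by simp
    then have "int p ^ 2 \<le> t ^ 2" by (metis abs_le_square_iff abs_of_nat)
    moreover have "0 \<le> s ^ 2" "0 < int p ^ 2" using p_gt3 by simp_all
    ultimately show False using that(1) by linarith
  qed
  have f: "(L * M' - L' * M) * (L * M' + L' * M) = 4 * int p * (M' ^ 2 - M ^ 2)"
  proof -
    have "(L * M' - L' * M) * (L * M' + L' * M) = (L ^ 2 + 27 * M ^ 2) * M' ^ 2 - (L' ^ 2 + 27 * M' ^ 2) * M ^ 2"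
      by (simp add: power2_eq_square algebra_simps)
    then show ?thesis unfolding 1[symmetric] 2[symmetric] by (simp add: algebra_simps)
  qed
  have "16 * int p ^ 2 = (4 * int p) * (4 * int p)" by (simp add: power2_eq_square)
  also have "\<dots> = (L ^ 2 + 27 * M ^ 2) * (L' ^ 2 + 27 * M' ^ 2)" by (subst (1) 1, subst 2) simp
  finally have g: "16 * int p ^ 2 = (L ^ 2 + 27 * M ^ 2) * (L' ^ 2 + 27 * M' ^ 2)" .
  have "(L * L' + 27 * M * M') ^ 2 + 27 * (L * M' - L' * M) ^ 2 = 16 * int p ^ 2"
    "(L * L' - 27 * M * M') ^ 2 + 27 * (L * M' + L' * M) ^ 2 = 16 * int p ^ 2"
    unfolding g by (simp_all add: power2_eq_square algebra_simps)
  moreover have "int p dvd L * M' - L' * M \<or> int p dvd L * M' + L' * M"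
  proof -
    have "int p dvd (L * M' - L' * M) * (L * M' + L' * M)" unfolding f by simp
    then show ?thesis using prime_dvd_mult_iff[OF prime_int_p] by blast
  qed
  ultimately have "L * M' - L' * M = 0 \<or> L * M' + L' * M = 0" using vanish by blast
  then have "(L * M' - L' * M) * (L * M' + L' * M) = 0" by auto
  with f have "M' ^ 2 = M ^ 2" using p_gt3 by simp
  then have "L ^ 2 = L' ^ 2" using 1 2 by linarith
  then have "L = L' \<or> L = - L'" by (simp add: power2_eq_iff)
  then show ?thesis
  proof
    assume "L = - L'"
    then have "[- L' = 1] (mod 3)" using L by simp
    with L' have "[L' + - L' = 1 + 1] (mod 3)" by (intro cong_add)
    then show ?thesis by (simp add: cong_def)
  qed
qed

text \<open>\<open>u\<close> and \<open>v\<close> are the images of \<open>jacobi\<close> and its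
  conjugate, so \<open>u * v = p\<close> modulo \<open>p^2\<close> and \<open>u + v = L\<close>. As
  \<open>u = - C\<close> is a unit because \<open>2 * m < p\<close>, \<open>p\<close> divides
  \<open>v\<close> and \<open>v ^ 2\<close> drops out of
  \<open>- u * L = - (L ^ 2) + u * v + v ^ 2\<close>.\<close>

lemma central_binomial_cong:
  assumes "4 * int p = L ^ 2 + 27 * M ^ 2" "[L = 1] (mod 3)"
  shows "\<not> int p dvd L" "[int ((2 * m) choose m) * L = - (L ^ 2) + int p] (mod int p ^ 2)"
proof -
  obtain z where z: "[z ^ 2 + z + 1 = 0] (mod int p ^ 2)" by (rule obtain_cube_root)
  have "Complex (- 1 / 2) (sqrt 3 / 2) ^ 2 + Complex (- 1 / 2) (sqrt 3 / 2) + 1 = 0"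
    by (simp add: complex_eq_iff power2_eq_square)
  with z interpret cubic_character p m z "Complex (- 1 / 2) (sqrt 3 / 2)"
    by unfold_locales auto
  define C where "C = int ((2 * m) choose m)"
  define u v where "u = A - B - B * z" and "v = A + B * z"
  have u: "[u = - C] (mod int p ^ 2)"
    unfolding u_def C_def using cong_trans[OF cong_sym[OF unit_cong] jacobi_unit_cong] .
  have uv: "[u * v = int p] (mod int p ^ 2)"
  proof -
    have "u * v - int p = - (B ^ 2) * (z ^ 2 + z + 1)"
      unfolding u_def v_def norm_A_B[symmetric] by (simp add: power2_eq_square algebra_simps)
    moreover have "int p ^ 2 dvd z ^ 2 + z + 1" using z by (simp add: cong_iff_dvd_diff)
    ultimately show ?thesis by (simp add: cong_iff_dvd_diff)
  qed
  have uv_sum: "u + v = 2 * A - B" by (simp add: u_def v_def)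
  obtain d where d: "B = 3 * d" using A_B_mod_3(2) by blast
  obtain e where e: "A + int p = 3 * e" using A_B_mod_3(1) by blast
  \<comment> \<open>Modulo 3, \<open>A\<close> is \<open>- p\<close>, that is -1, and
    \<open>B\<close> is 0; this fixes the sign of \<open>2 * A - B\<close>.\<close>
  have "2 * A - B - 1 = 3 * (2 * e - d - 2 * int m - 1)"
    using e d p_eq by simp
  then have "[2 * A - B = 1] (mod 3)" by (simp only: cong_iff_dvd_diff dvd_triv_left)
  \<comment> \<open>Four times the norm form is \<open>(2 * A - B) ^ 2 + 3 * B ^ 2\<close>, and
    \<open>B = 3 * d\<close> turns 3 into 27.\<close>
  moreover have "4 * int p = (2 * A - B) ^ 2 + 27 * d ^ 2"
    unfolding norm_A_B[symmetric] d by (simp add: power2_eq_square algebra_simps)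
  ultimately have L: "L = u + v" using representation_unique assms unfolding uv_sum by blast
  have "\<not> int p dvd C"
  proof
    assume "int p dvd C"
    then have "p dvd ((2 * m) choose m)" by (simp add: C_def)
    also have "\<dots> dvd fact (2 * m)"
      using binomial_fact_lemma[of m "2 * m"] by (metis dvd_triv_right le_add1 mult_2)
    finally have "p \<le> 2 * m" using prime_dvd_fact_iff[OF prime_p] by blast
    then show False using p_eq by simp
  qed
  moreover have "int p dvd u \<longleftrightarrow> int p dvd - C" using cong_mod_p_of_mod_p2[OF u] by (rule cong_dvd_iff)
  ultimately have nu: "\<not> int p dvd u" by simp
  have "int p dvd u * v" using cong_mod_p_of_mod_p2[OF uv] by (simp add: cong_dvd_iff)
  then have v: "int p dvd v" using nu prime_dvd_mult_iff[OF prime_int_p] by blast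
  show "\<not> int p dvd L" using nu v unfolding L by (simp add: dvd_add_left_iff)
  have "[C * L = - u * L] (mod int p ^ 2)"
    using cong_scalar_right[OF u, of "- L"] by (simp add: cong_sym)
  also have "- u * L = - (L ^ 2) + u * v + v ^ 2"
    by (simp add: L power2_eq_square algebra_simps)
  finally have "[C * L = - (L ^ 2) + u * v + v ^ 2] (mod int p ^ 2)" .
  moreover have "[- (L ^ 2) + u * v + v ^ 2 = - (L ^ 2) + int p + 0] (mod int p ^ 2)"
    using v by (intro cong_add uv cong_refl) (simp add: cong_iff_dvd_diff dvd_power_same)
  ultimately show "[int ((2 * m) choose m) * L = - (L ^ 2) + int p] (mod int p ^ 2)"
    unfolding C_def by (simp add: cong_def)
qed

lemma sum_cong_representation:
  assumes "4 * int p = L ^ 2 + 27 * M ^ 2" "[L = 1] (mod 3)"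
  shows "(\<Sum>k = 0..m. hyp_term k * (of_nat p / of_nat (3 * k + 1))) \<approx>[2] - of_int L + of_nat p / of_int L"
proof -
  note L = central_binomial_cong[OF assms]
  obtain z where z: "[z ^ 2 + z + 1 = 0] (mod int p ^ 2)" by (rule obtain_cube_root)
  note sum_cong_1_mod_3[OF z]
  also have "of_nat ((2 * m) choose m) \<approx>[2] - of_int L + of_nat p / of_int L"
  proof -
    have "L \<noteq> 0" using L(1) by auto
    have "of_int (int ((2 * m) choose m) * L) \<approx>[2] of_int (- (L ^ 2) + int p)"
      unfolding pcong_of_int_iff by (rule L(2))
    then have "of_int (int ((2 * m) choose m) * L) / of_int L \<approx>[2] of_int (- (L ^ 2) + int p) / of_int L"
      using L(1) by (intro pcong_div) auto
    then show ?thesis using \<open>L \<noteq> 0\<close> by (simp add: add_divide_distrib diff_divide_distrib power2_eq_square)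
  qed
  finally show ?thesis .
qed

end

theorem theorem5p4:
  fixes p :: nat
  assumes "prime p" and "p > 3"
  shows "cong_p_integral p (of_nat p ^ 2)
           (\<Sum>n = 0..p - 1. of_int (W n) / (- 3) ^ n)
           (\<Sum>k = 0..p div 3. of_nat (((2 * k) choose k) * ((3 * k) choose k)) / 27 ^ k
              * (of_nat p / of_nat (3 * k + 1)))
       \<and> ([p = 1] (mod 3) \<longrightarrow>
           (\<forall>L M :: int. 4 * int p = L ^ 2 + 27 * M ^ 2 \<and> [L = 1] (mod 3) \<longrightarrow>
             cong_p_integral p (of_nat p ^ 2)
               (\<Sum>k = 0..p div 3. of_nat (((2 * k) choose k) * ((3 * k) choose k)) / 27 ^ k
                  * (of_nat p / of_nat (3 * k + 1)))
               (- of_int L + of_nat p / of_int L)))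
       \<and> ([p = 2] (mod 3) \<longrightarrow>
           cong_p_integral p (of_nat p ^ 2)
             (\<Sum>k = 0..p div 3. of_nat (((2 * k) choose k) * ((3 * k) choose k)) / 27 ^ k
                * (of_nat p / of_nat (3 * k + 1)))
             (- (of_nat p / 3) * (of_nat (fact ((p - 2) div 3))) ^ 3))"
proof -
  interpret prime_gt3 p using assms by unfold_locales
  have 1: "cong_p_integral p (of_nat p ^ 2) (\<Sum>k = 0..p div 3. hyp_term k * (of_nat p / of_nat (3 * k + 1)))
      (- of_int L + of_nat p / of_int L)"
    if "[p = 1] (mod 3)" and L: "4 * int p = L ^ 2 + 27 * M ^ 2" "[L = 1] (mod 3)" for L M :: int
  proof -
    have p: "p = 3 * (p div 3) + 1" using that(1) unfolding cong_def by presburger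
    interpret prime_1_mod_3 p "p div 3" using p by unfold_locales
    show ?thesis by (rule sum_cong_representation[OF L])
  qed
  have 2: "cong_p_integral p (of_nat p ^ 2) (\<Sum>k = 0..p div 3. hyp_term k * (of_nat p / of_nat (3 * k + 1)))
      (- (of_nat p / 3) * (of_nat (fact ((p - 2) div 3))) ^ 3)" if "[p = 2] (mod 3)"
  proof -
    have p: "p = 3 * (p div 3) + 2" using that unfolding cong_def by presburger
    then have "(p - 2) div 3 = p div 3" by presburger
    then show ?thesis using sum_cong_2_mod_3[OF p] by simp
  qed
  show ?thesis
    unfolding hyp_term_def[symmetric] using sum_W_cong 1 2 by blast
qed

end
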